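(* Let $(R,\mathfrak{m}_R,\ell)$ be a commutative noetherian local ring whose maximal ideal $\mathfrak{m}_R$ is decomposable. If $R$ is artinian, then there is no non-free finitely generated $R$-module $M$ such that $\operatorname{Ext}^i_R(M,R)=0$ for all $i\gg 0$. In particular, $R$ has no non-free totally reflexive modules.
   Context: The maximal ideal $\mathfrak{m}_R$ is decomposable if $\mathfrak{m}_R=I\oplus J$ for some non-zero ideals $I,J$ of $R$. A finitely generated $R$-module $X$ is totally reflexive if $\operatorname{Hom}_R(\operatorname{Hom}_R(X,R),R)\cong X$ and $\operatorname{Ext}^i_R(X,R)=0=\operatorname{Ext}^i_R(\operatorname{Hom}_R(X,R),R)$ for all $i>0$. *)

theory Defs
  imports "HOL-Algebra.Ring_Divisibility"
    "Jordan_Normal_Form.Missing_VectorSpace"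
begin

section \<open>Local rings and chain conditions\<close>

definition local_ring :: "('a, 'r) ring_scheme \<Rightarrow> 'a set \<Rightarrow> bool"
  where "local_ring R m \<longleftrightarrow>
    cring R \<and> maximalideal m R \<and> (\<forall>n. maximalideal n R \<longrightarrow> n = m)"

definition artinian_ring :: "('a, 'r) ring_scheme \<Rightarrow> bool"
  where "artinian_ring R \<longleftrightarrow> cring R \<and>
    (\<forall>C :: nat \<Rightarrow> 'a set. (\<forall>i. ideal (C i) R) \<longrightarrow> (\<forall>i. C (Suc i) \<subseteq> C i) \<longrightarrow>
       (\<exists>n. \<forall>i\<ge>n. C i = C n))"

definition decomposable_ideal :: "('a, 'r) ring_scheme \<Rightarrow> 'a set \<Rightarrow> bool"
  where "decomposable_ideal R m \<longleftrightarrow>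
    (\<exists>I J. ideal I R \<and> ideal J R \<and> I \<noteq> {\<zero>\<^bsub>R\<^esub>} \<and> J \<noteq> {\<zero>\<^bsub>R\<^esub>} \<and>
       I \<inter> J = {\<zero>\<^bsub>R\<^esub>} \<and> m = I <+>\<^bsub>R\<^esub> J)"


section \<open>Modules\<close>

text \<open>
  Module records extend ring records; the fields \<open>mult\<close> and \<open>one\<close> play no role for a module and
  receive arbitrary values in the Hom and quotient modules below.
\<close>

definition fg_module :: "('a, 'r) ring_scheme \<Rightarrow> ('a, 'm, 'z) module_scheme \<Rightarrow> bool"
  where "fg_module R M \<longleftrightarrow> module R M \<and>
    (\<exists>S \<subseteq> carrier M. finite S \<and> LinearCombinations.module.span R M S = carrier M)"

definition free_module :: "('a, 'r) ring_scheme \<Rightarrow> ('a, 'm, 'z) module_scheme \<Rightarrow> bool"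
  where "free_module R M \<longleftrightarrow> module R M \<and>
    (\<exists>B \<subseteq> carrier M. \<not> LinearCombinations.module.lin_dep R M B \<and>
       LinearCombinations.module.span R M B = carrier M)"

definition zero_module :: "('a, 'm, 'z) module_scheme \<Rightarrow> bool"
  where "zero_module M \<longleftrightarrow> carrier M = {\<zero>\<^bsub>M\<^esub>}"

definition isomorphic_modules ::
    "('a, 'r) ring_scheme \<Rightarrow> ('a, 'm, 'y) module_scheme \<Rightarrow> ('a, 'n, 'z) module_scheme \<Rightarrow> bool"
  where "isomorphic_modules R M N \<longleftrightarrow>
    (\<exists>f \<in> module_hom R M N. bij_betw f (carrier M) (carrier N))"

definition ring_module :: "('a, 'r) ring_scheme \<Rightarrow> ('a, 'a) module"
  where "ring_module R =
    \<lparr>carrier = carrier R, mult = mult R, one = one R, zero = zero R, add = add R,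
     smult = mult R\<rparr>"

text \<open>
  The constant \<^const>\<open>module_hom\<close> does not constrain functions outside the carrier, so the
  elements of the Hom module are taken to be extensional.
\<close>

definition hom_module ::
    "('a, 'r) ring_scheme \<Rightarrow> ('a, 'm, 'y) module_scheme \<Rightarrow> ('a, 'n, 'z) module_scheme \<Rightarrow>
     ('a, 'm \<Rightarrow> 'n) module"
  where "hom_module R M N =
    \<lparr>carrier = module_hom R M N \<inter> extensional (carrier M),
     mult = (\<lambda>f g. \<lambda>x\<in>carrier M. \<zero>\<^bsub>N\<^esub>),
     one = (\<lambda>x\<in>carrier M. \<zero>\<^bsub>N\<^esub>),
     zero = (\<lambda>x\<in>carrier M. \<zero>\<^bsub>N\<^esub>),
     add = (\<lambda>f g. \<lambda>x\<in>carrier M. f x \<oplus>\<^bsub>N\<^esub> g x),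
     smult = (\<lambda>r f. \<lambda>x\<in>carrier M. r \<odot>\<^bsub>N\<^esub> f x)\<rparr>"

definition quotient_module :: "('a, 'm, 'z) module_scheme \<Rightarrow> 'm set \<Rightarrow> ('a, 'm set) module"
  where "quotient_module M N =
    \<lparr>carrier = a_rcosets\<^bsub>M\<^esub> N,
     mult = (\<lambda>X Y. N),
     one = N,
     zero = N,
     add = set_add M,
     smult = (\<lambda>r X. \<Union>x\<in>X. N +>\<^bsub>M\<^esub> (r \<odot>\<^bsub>M\<^esub> x))\<rparr>"


section \<open>Ext\<close>

text \<open>
  The exact complex \<open>\<dots> \<rightarrow> F 2 \<rightarrow> F 1 \<rightarrow> F 0 \<rightarrow> M \<rightarrow> 0\<close> with finitely generated free \<open>F i\<close>;
  the differential \<open>d i\<close> goes from \<open>F (Suc i)\<close> to \<open>F i\<close>.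
\<close>

definition fg_free_resolution ::
    "('a, 'r) ring_scheme \<Rightarrow> ('a, 'm, 'z) module_scheme \<Rightarrow>
     (nat \<Rightarrow> ('a, 'p) module) \<Rightarrow> (nat \<Rightarrow> 'p \<Rightarrow> 'p) \<Rightarrow> ('p \<Rightarrow> 'm) \<Rightarrow> bool"
  where "fg_free_resolution R M F d e \<longleftrightarrow>
    (\<forall>i. fg_module R (F i) \<and> free_module R (F i)) \<and>
    (\<forall>i. d i \<in> module_hom R (F (Suc i)) (F i)) \<and>
    e \<in> module_hom R (F 0) M \<and>
    e ` carrier (F 0) = carrier M \<and>
    d 0 ` carrier (F 1) = {x \<in> carrier (F 0). e x = \<zero>\<^bsub>M\<^esub>} \<and>
    (\<forall>i. d (Suc i) ` carrier (F (Suc (Suc i))) =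
           {x \<in> carrier (F (Suc i)). d i x = \<zero>\<^bsub>F i\<^esub>})"

definition hom_differential ::
    "(nat \<Rightarrow> ('a, 'p) module) \<Rightarrow> (nat \<Rightarrow> 'p \<Rightarrow> 'p) \<Rightarrow> nat \<Rightarrow> ('p \<Rightarrow> 'n) \<Rightarrow> ('p \<Rightarrow> 'n)"
  where "hom_differential F d i f = compose (carrier (F (Suc i))) f (d i)"

definition cocycles ::
    "('a, 'r) ring_scheme \<Rightarrow> (nat \<Rightarrow> ('a, 'p) module) \<Rightarrow> (nat \<Rightarrow> 'p \<Rightarrow> 'p) \<Rightarrow>
     ('a, 'n, 'z) module_scheme \<Rightarrow> nat \<Rightarrow> ('p \<Rightarrow> 'n) set"
  where "cocycles R F d N i =
    {f \<in> carrier (hom_module R (F i) N).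
       hom_differential F d i f = \<zero>\<^bsub>hom_module R (F (Suc i)) N\<^esub>}"

fun coboundaries ::
    "('a, 'r) ring_scheme \<Rightarrow> (nat \<Rightarrow> ('a, 'p) module) \<Rightarrow> (nat \<Rightarrow> 'p \<Rightarrow> 'p) \<Rightarrow>
     ('a, 'n, 'z) module_scheme \<Rightarrow> nat \<Rightarrow> ('p \<Rightarrow> 'n) set"
  where
    "coboundaries R F d N 0 = {\<zero>\<^bsub>hom_module R (F 0) N\<^esub>}"
  | "coboundaries R F d N (Suc i) = hom_differential F d i ` carrier (hom_module R (F i) N)"

definition hom_cohomology ::
    "('a, 'r) ring_scheme \<Rightarrow> (nat \<Rightarrow> ('a, 'p) module) \<Rightarrow> (nat \<Rightarrow> 'p \<Rightarrow> 'p) \<Rightarrow>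
     ('a, 'n, 'z) module_scheme \<Rightarrow> nat \<Rightarrow> ('a, ('p \<Rightarrow> 'n) set) module"
  where "hom_cohomology R F d N i =
    quotient_module ((hom_module R (F i) N)\<lparr>carrier := cocycles R F d N i\<rparr>)
      (coboundaries R F d N i)"

text \<open>
  The module \<open>Ext R M N i\<close> is the \<open>i\<close>-th cohomology of \<open>Hom(F, N)\<close> for a chosen resolution \<open>F\<close> of \<open>M\<close> by
  finitely generated free modules.  Such a resolution exists when \<open>R\<close> is noetherian and \<open>M\<close> is
  finitely generated, and the definition is intended for this case only; up to isomorphism the
  result does not depend on the choice.  Elements of type \<^typ>\<open>nat \<Rightarrow> 'a\<close> suffice for the modules
  of the resolution, since every \<open>R\<^sup>n\<close> can be realised there.
\<close>

definition Ext ::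
    "('a, 'r) ring_scheme \<Rightarrow> ('a, 'm, 'y) module_scheme \<Rightarrow> ('a, 'n, 'z) module_scheme \<Rightarrow>
     nat \<Rightarrow> ('a, ((nat \<Rightarrow> 'a) \<Rightarrow> 'n) set) module"
  where "Ext R M N i =
    (let (F, d, e) = (SOME (F :: nat \<Rightarrow> ('a, nat \<Rightarrow> 'a) module, d, e). fg_free_resolution R M F d e)
     in hom_cohomology R F d N i)"


section \<open>Totally reflexive modules\<close>

definition dual_module ::
    "('a, 'r) ring_scheme \<Rightarrow> ('a, 'm, 'z) module_scheme \<Rightarrow> ('a, 'm \<Rightarrow> 'a) module"
  where "dual_module R M = hom_module R M (ring_module R)"

definition totally_reflexive ::
    "('a, 'r) ring_scheme \<Rightarrow> ('a, 'm, 'z) module_scheme \<Rightarrow> bool"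
  where "totally_reflexive R X \<longleftrightarrow> fg_module R X \<and>
    isomorphic_modules R (dual_module R (dual_module R X)) X \<and>
    (\<forall>i>0. zero_module (Ext R X (ring_module R) i)) \<and>
    (\<forall>i>0. zero_module (Ext R (dual_module R X) (ring_module R) i))"

end

theory Submission
  imports Defs
begin

text \<open>
  Let \<open>\<mm> = I \<oplus> J\<close>, so that \<open>I J = 0\<close>, and let \<open>M\<close> be finitely generated and not free.  As \<open>R\<close> is artinian,
  every nonzero ideal contains a nonzero element killed by \<open>\<mm>\<close>; hence no syzygy in a minimal free
  resolution of \<open>M\<close> vanishes.  Let \<open>T = ker (R\<^sup>b \<rightarrow> R\<^sup>a)\<close> be a syzygy of a syzygy.  Since \<open>T \<subseteq> \<mm> R\<^sup>b\<close>, it splits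
  as \<open>(T \<inter> I R\<^sup>b) \<oplus> (T \<inter> J R\<^sup>b)\<close>, and one summand \<open>A\<close>, say the second, is nonzero.

  Let \<open>K = ker (p : R\<^sup>c \<rightarrow> A)\<close> for a minimal cover \<open>p\<close> and let \<open>u\<close> be the first unit vector of \<open>R\<^sup>c\<close>.  Pick
  \<open>y \<in> I\<close> nonzero and \<open>x \<in> J\<close> nonzero with \<open>\<mm> x = 0\<close>.  Then \<open>x u\<close> and \<open>y u\<close> lie in \<open>K \<subseteq> \<mm> R\<^sup>c\<close>, and
  the map \<open>K \<rightarrow> R\<close> taking \<open>z\<close> to the \<open>I\<close>-part of its first coordinate maps them to \<open>0\<close> and \<open>y\<close>.
  If it extended to \<open>\<psi> : R\<^sup>c \<rightarrow> R\<close>, then \<open>y \<psi>(u) = y\<close> would force \<open>\<psi>(u) - 1 \<in> \<mm>\<close>, so that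
  \<open>0 = x \<psi>(u) = x\<close>, a contradiction.

  If \<open>Ext\<close> vanishes in high degrees, then homomorphisms from high syzygies of an arbitrary resolution by
  finitely generated free modules to \<open>R\<close> extend.  A comparison in the style of Schanuel's lemma
  transfers this property to the minimal resolution and its direct summands.
\<close>

section \<open>Local rings\<close>

text \<open>Zorn's lemma for the proper ideals above \<open>K\<close>. In a noetherian ring a
  nonempty chain of ideals contains its own union, so the union is again a proper ideal above
  \<open>K\<close>.\<close>

lemma (in noetherian_ring) proper_ideal_subset_maximalideal:
  assumes "ideal K R" "K \<noteq> carrier R"
  shows "\<exists>n. maximalideal n R \<and> K \<subseteq> n"
proof -
  let ?P = "{L. ideal L R \<and> K \<subseteq> L \<and> L \<noteq> carrier R}"
  have ub: "\<exists>U\<in>?P. \<forall>X\<in>C. X \<subseteq> U" if C: "subset.chain ?P C" for C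
  proof (cases "C = {}")
    case True
    then show ?thesis using assms by blast
  next
    case False
    have "subset.chain {L. ideal L R} C"
      using C unfolding pred_on.chain_def by blast
    from ideal_chain_is_trivial[OF False this] have "\<Union>C \<in> C" .
    moreover have "C \<subseteq> ?P" using C unfolding pred_on.chain_def by blast
    ultimately have "\<Union>C \<in> ?P" by (rule rev_subsetD)
    then show ?thesis by (rule rev_bexI) (simp add: Union_upper)
  qed
  have "\<exists>n\<in>?P. \<forall>X\<in>?P. n \<subseteq> X \<longrightarrow> X = n"
    by (rule subset_Zorn) (rule ub)
  then obtain n where n: "n \<in> ?P" and mx: "\<forall>X\<in>?P. n \<subseteq> X \<longrightarrow> X = n"
    by (rule bexE)
  have "maximalideal n R"
  proof (rule maximalidealI)
    show "ideal n R" "carrier R \<noteq> n" using n by auto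
    show "J = n \<or> J = carrier R" if "ideal J R" "n \<subseteq> J" "J \<subseteq> carrier R" for J
      using that n mx by blast
  qed
  then show ?thesis using n by blast
qed

text \<open>Otherwise the principal ideal of \<open>r\<close> would be proper, hence inside some
  maximal ideal, and the only one is \<open>m\<close>.\<close>

lemma local_ring_Units:
  assumes "noetherian_ring R" "local_ring R m" "r \<in> carrier R" "r \<notin> m"
  shows "r \<in> Units R"
proof -
  interpret cring R using assms(2) by (simp add: local_ring_def)
  interpret N: noetherian_ring R by fact
  have "PIdl\<^bsub>R\<^esub> r = carrier R"
  proof (rule ccontr)
    assume "PIdl\<^bsub>R\<^esub> r \<noteq> carrier R"
    then obtain n where "maximalideal n R" "PIdl\<^bsub>R\<^esub> r \<subseteq> n"
      using N.proper_ideal_subset_maximalideal[OF cgenideal_ideal[OF assms(3)]] by blast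
    then have "PIdl\<^bsub>R\<^esub> r \<subseteq> m" using assms(2) by (auto simp: local_ring_def)
    then show False using cgenideal_self[OF assms(3)] assms(4) by blast
  qed
  then show ?thesis using ideal_eq_carrier_iff[OF assms(3)] by simp
qed

section \<open>Finite free modules\<close>

text \<open>\<open>R^a\<close> as the sequences that vanish from index \<open>a\<close> on. All
  ranks share one type, the one over which \<open>Ext\<close> picks its resolutions, and a smaller
  free module is literally a subset of a larger one.\<close>

definition fr :: "('a, 'r) ring_scheme \<Rightarrow> nat \<Rightarrow> ('a, nat \<Rightarrow> 'a) module"
  where "fr R a =
    \<lparr>carrier = {v. (\<forall>i. v i \<in> carrier R) \<and> (\<forall>i\<ge>a. v i = \<zero>\<^bsub>R\<^esub>)},
     mult = (\<lambda>u v. u), one = (\<lambda>i. \<zero>\<^bsub>R\<^esub>), zero = (\<lambda>i. \<zero>\<^bsub>R\<^esub>),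
     add = (\<lambda>u v i. u i \<oplus>\<^bsub>R\<^esub> v i), smult = (\<lambda>r v i. r \<otimes>\<^bsub>R\<^esub> v i)\<rparr>"

lemma fr_simps [simp]:
  "\<zero>\<^bsub>fr R a\<^esub> = (\<lambda>i. \<zero>\<^bsub>R\<^esub>)"
  "u \<oplus>\<^bsub>fr R a\<^esub> v = (\<lambda>i. u i \<oplus>\<^bsub>R\<^esub> v i)"
  "r \<odot>\<^bsub>fr R a\<^esub> v = (\<lambda>i. r \<otimes>\<^bsub>R\<^esub> v i)"
  by (simp_all add: fr_def)

lemma fr_carrier: "v \<in> carrier (fr R a) \<longleftrightarrow> (\<forall>i. v i \<in> carrier R) \<and> (\<forall>i\<ge>a. v i = \<zero>\<^bsub>R\<^esub>)"
  by (simp add: fr_def)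

definition unitv :: "('a, 'r) ring_scheme \<Rightarrow> nat \<Rightarrow> nat \<Rightarrow> 'a"
  where "unitv R i = (\<lambda>j. if j = i then \<one>\<^bsub>R\<^esub> else \<zero>\<^bsub>R\<^esub>)"

text \<open>The linear map out of \<open>R^a\<close> that takes the i-th unit vector to
  \<open>y i\<close>.\<close>

definition lin :: "('a, 'm, 'z) module_scheme \<Rightarrow> (nat \<Rightarrow> 'm) \<Rightarrow> nat \<Rightarrow> (nat \<Rightarrow> 'a) \<Rightarrow> 'm"
  where "lin N y a v = (\<Oplus>\<^bsub>N\<^esub>i\<in>{..<a}. v i \<odot>\<^bsub>N\<^esub> y i)"

context cring
begin

lemma module_fr: "module R (fr R a)"
proof (rule module_criteria)
  show "\<forall>v\<in>carrier (fr R a). \<exists>w\<in>carrier (fr R a). v \<oplus>\<^bsub>fr R a\<^esub> w = \<zero>\<^bsub>fr R a\<^esub>"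
  proof
    fix v assume "v \<in> carrier (fr R a)"
    then have "(\<lambda>i. \<ominus> v i) \<in> carrier (fr R a)"
        "v \<oplus>\<^bsub>fr R a\<^esub> (\<lambda>i. \<ominus> v i) = \<zero>\<^bsub>fr R a\<^esub>"
      by (simp_all add: fr_carrier r_neg)
    then show "\<exists>w\<in>carrier (fr R a). v \<oplus>\<^bsub>fr R a\<^esub> w = \<zero>\<^bsub>fr R a\<^esub>" by blast
  qed
  show "cring R" by (rule is_cring)
qed (auto simp: fr_carrier m_assoc l_distr r_distr intro!: ext a_assoc intro: a_comm)

lemma unitv_closed: "i < a \<Longrightarrow> unitv R i \<in> carrier (fr R a)"
  by (auto simp: fr_carrier unitv_def)

section \<open>Linear maps out of \<open>R^a\<close>\<close>

lemma lin_hom: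
  assumes "module R N" "\<And>i. i < a \<Longrightarrow> y i \<in> carrier N"
  shows "lin N y a \<in> module_hom R (fr R a) N"
proof -
  interpret N: module R N by fact
  show ?thesis
    unfolding module_hom_def
  proof (intro CollectI conjI allI impI funcsetI)
    show "lin N y a v \<in> carrier N" if "v \<in> carrier (fr R a)" for v
      using that assms(2) by (auto simp: lin_def fr_carrier intro!: N.M.finsum_closed)
    show "lin N y a (u \<oplus>\<^bsub>fr R a\<^esub> v) = lin N y a u \<oplus>\<^bsub>N\<^esub> lin N y a v"
      if "u \<in> carrier (fr R a) \<and> v \<in> carrier (fr R a)" for u v
    proof -
      have "lin N y a (u \<oplus>\<^bsub>fr R a\<^esub> v)
          = (\<Oplus>\<^bsub>N\<^esub>i\<in>{..<a}. u i \<odot>\<^bsub>N\<^esub> y i \<oplus>\<^bsub>N\<^esub> v i \<odot>\<^bsub>N\<^esub> y i)"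
        unfolding lin_def using that assms(2)
        by (intro N.M.finsum_cong') (auto simp: fr_carrier N.smult_l_distr)
      also have "\<dots> = lin N y a u \<oplus>\<^bsub>N\<^esub> lin N y a v"
        unfolding lin_def using that assms(2)
        by (intro N.M.finsum_addf) (auto simp: fr_carrier)
      finally show ?thesis .
    qed
    show "lin N y a (r \<odot>\<^bsub>fr R a\<^esub> v) = r \<odot>\<^bsub>N\<^esub> lin N y a v"
      if "r \<in> carrier R \<and> v \<in> carrier (fr R a)" for r v
    proof -
      have "lin N y a (r \<odot>\<^bsub>fr R a\<^esub> v) = (\<Oplus>\<^bsub>N\<^esub>i\<in>{..<a}. r \<odot>\<^bsub>N\<^esub> (v i \<odot>\<^bsub>N\<^esub> y i))"
        unfolding lin_def using that assms(2)
        by (intro N.M.finsum_cong') (auto simp: fr_carrier N.smult_assoc1)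
      also have "\<dots> = r \<odot>\<^bsub>N\<^esub> lin N y a v"
        unfolding lin_def using that assms(2)
        by (subst N.finsum_smult_ldistr) (auto simp: fr_carrier)
      finally show ?thesis .
    qed
  qed
qed

lemma lin_unitv:
  assumes "module R N" "\<And>i. i < a \<Longrightarrow> y i \<in> carrier N" "i < a"
  shows "lin N y a (unitv R i) = y i"
proof -
  interpret N: module R N by fact
  have "lin N y a (unitv R i) = (\<Oplus>\<^bsub>N\<^esub>j\<in>{..<a}. if i = j then y j else \<zero>\<^bsub>N\<^esub>)"
    unfolding lin_def unitv_def using assms
    by (intro N.M.finsum_cong') auto
  also have "\<dots> = y i"
    using assms by (intro N.M.finsum_singleton) auto
  finally show ?thesis .
qed

lemma lin_Suc:
  assumes "module R N" "\<And>i. i \<le> k \<Longrightarrow> y i \<in> carrier N" "\<And>i. v i \<in> carrier R"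
  shows "lin N y (Suc k) v = v k \<odot>\<^bsub>N\<^esub> y k \<oplus>\<^bsub>N\<^esub> lin N y k v"
proof -
  interpret N: module R N by fact
  show ?thesis
    unfolding lin_def lessThan_Suc using assms by (subst N.M.finsum_insert) auto
qed

lemma lin_cong:
  assumes "module R N" "\<And>i. i < a \<Longrightarrow> y i = z i" "\<And>i. i < a \<Longrightarrow> z i \<in> carrier N"
    "\<And>i. i < a \<Longrightarrow> v i = w i" "\<And>i. i < a \<Longrightarrow> w i \<in> carrier R"
  shows "lin N y a v = lin N z a w"
proof -
  interpret N: module R N by fact
  show ?thesis
    unfolding lin_def using assms by (intro N.M.finsum_cong') auto
qed

lemma lin_in_submodule:
  assumes N: "module R N" and Y: "LinearCombinations.submodule R Y N"
    and y: "\<And>i. i < a \<Longrightarrow> y i \<in> Y" and v: "\<And>i. v i \<in> carrier R"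
  shows "lin N y a v \<in> Y"
proof -
  interpret Y: LinearCombinations.submodule R Y N by fact
  have "k \<le> a \<Longrightarrow> lin N y k v \<in> Y" for k
  proof (induction k)
    case 0
    interpret N: module R N by fact
    show ?case by (simp add: lin_def)
  next
    case (Suc k)
    then have "lin N y (Suc k) v = v k \<odot>\<^bsub>N\<^esub> y k \<oplus>\<^bsub>N\<^esub> lin N y k v"
      using y v Y.subset by (intro lin_Suc[OF N]) auto
    then show ?case using Suc y v by simp
  qed
  then show ?thesis by simp
qed

text \<open>Induction on \<open>k\<close> for the truncation of \<open>v\<close> to its first
  \<open>k\<close> coordinates: each step adds one multiple of a unit vector, and linearity of
  \<open>f\<close> matches \<open>lin_Suc\<close>.\<close>

lemma hom_fr_eq_lin:
  assumes N: "module R N" and f: "f \<in> module_hom R (fr R a) N" and v: "v \<in> carrier (fr R a)"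
  shows "f v = lin N (\<lambda>i. f (unitv R i)) a v"
proof -
  interpret N: module R N by fact
  interpret F: module R "fr R a" by (rule module_fr)
  interpret h: mod_hom R "fr R a" N f by unfold_locales (rule f)
  define tr where "tr k = (\<lambda>i. if i < k then v i else \<zero>)" for k :: nat
  have tr: "tr k \<in> carrier (fr R a)" for k
    using v by (auto simp: tr_def fr_carrier)
  have "k \<le> a \<Longrightarrow> f (tr k) = lin N (\<lambda>i. f (unitv R i)) k v" for k
  proof (induction k)
    case 0
    show ?case using h.f0_is_0 by (simp add: tr_def lin_def)
  next
    case (Suc k)
    have vk: "v k \<in> carrier R" using v by (simp add: fr_carrier)
    have u: "f (unitv R i) \<in> carrier N" if "i \<le> k" for i
      using Suc.prems that by (intro h.f_im unitv_closed) simp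
    have "tr (Suc k) = v k \<odot>\<^bsub>fr R a\<^esub> unitv R k \<oplus>\<^bsub>fr R a\<^esub> tr k"
      using v by (auto simp: tr_def unitv_def fun_eq_iff fr_carrier less_Suc_eq)
    then have "f (tr (Suc k)) = v k \<odot>\<^bsub>N\<^esub> f (unitv R k) \<oplus>\<^bsub>N\<^esub> f (tr k)"
      using Suc.prems vk tr unitv_closed[of k a]
        h.f_add[OF F.smult_closed[OF vk unitv_closed[of k a]] tr[of k]]
      by (simp del: fr_simps)
    then show ?case
      using Suc u v by (subst lin_Suc[OF N]) (auto simp: fr_carrier)
  qed
  moreover have "tr a = v" using v by (auto simp: tr_def fr_carrier fun_eq_iff)
  ultimately show ?thesis by (metis order_refl)
qed

text \<open>Projectivity of \<open>R^a\<close>: choose preimages under \<open>q\<close> of the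
  values of \<open>f\<close> at the unit vectors. The condition on images replaces surjectivity of
  \<open>q\<close>, because \<open>q\<close> will be a cover of a submodule of
  \<open>N\<close>.\<close>

lemma fr_lift:
  assumes N: "module R N" and Q: "module R Q" and q: "q \<in> module_hom R Q N"
    and f: "f \<in> module_hom R (fr R a) N" and sub: "f ` carrier (fr R a) \<subseteq> q ` carrier Q"
  shows "\<exists>g \<in> module_hom R (fr R a) Q. \<forall>v\<in>carrier (fr R a). q (g v) = f v"
proof -
  have "\<exists>y. y \<in> carrier Q \<and> q y = f (unitv R i)" if "i < a" for i
    using sub unitv_closed[OF that] by (metis imageE image_subset_iff)
  then obtain y where y: "\<And>i. i < a \<Longrightarrow> y i \<in> carrier Q \<and> q (y i) = f (unitv R i)"
    by metis
  let ?g = "lin Q y a"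
  have g: "?g \<in> module_hom R (fr R a) Q" using lin_hom[OF Q] y by blast
  have "(\<lambda>v. q (?g v)) \<in> module_hom R (fr R a) N"
    using g q unfolding module_hom_def by (auto simp: Pi_iff)
  then have "q (?g v) = lin N (\<lambda>i. q (?g (unitv R i))) a v" if "v \<in> carrier (fr R a)" for v
    using hom_fr_eq_lin[OF N, of "\<lambda>v. q (?g v)"] that by simp
  moreover have "lin N (\<lambda>i. q (?g (unitv R i))) a v = f v" if v: "v \<in> carrier (fr R a)" for v
  proof -
    have "f (unitv R i) \<in> carrier N" if "i < a" for i
      using f unitv_closed[OF that] unfolding module_hom_def by blast
    then show ?thesis
      unfolding hom_fr_eq_lin[OF N f v]
      using y lin_unitv[OF Q, of a y] v
      by (intro lin_cong[OF N]) (auto simp: fr_carrier)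
  qed
  ultimately show ?thesis using g by auto
qed

end

section \<open>Generators, covers and free modules\<close>

text \<open>Phrased through the submodules of the ambient module \<open>N\<close>, so that a
  submodule \<open>X\<close> can be treated without forming it as a module of its own.\<close>

definition generates ::
    "('a, 'r) ring_scheme \<Rightarrow> ('a, 'm, 'z) module_scheme \<Rightarrow> 'm set \<Rightarrow> 'm set \<Rightarrow> bool"
  where "generates R N S X \<longleftrightarrow>
    S \<subseteq> X \<and> (\<forall>Y. LinearCombinations.submodule R Y N \<longrightarrow> S \<subseteq> Y \<longrightarrow> X \<subseteq> Y)"

lemma submodule_Int:
  "LinearCombinations.submodule R X N \<Longrightarrow> LinearCombinations.submodule R Y N \<Longrightarrow>
    LinearCombinations.submodule R (X \<inter> Y) N"
  by (auto simp: LinearCombinations.submodule_def)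

lemma submodule_uminus:
  assumes "LinearCombinations.submodule R X N" "x \<in> X"
  shows "\<ominus>\<^bsub>N\<^esub> x \<in> X"
proof -
  interpret LinearCombinations.submodule R X N by fact
  interpret N: module R N by (rule module)
  have "\<ominus>\<^bsub>N\<^esub> x = (\<ominus>\<^bsub>R\<^esub> \<one>\<^bsub>R\<^esub>) \<odot>\<^bsub>N\<^esub> x" 
    using assms(2) subset by (simp add: N.smult_minus_1 subset_iff)
  then show ?thesis using assms(2) by simp
qed

lemma submodule_minus:
  assumes "LinearCombinations.submodule R X N" "x \<in> X" "y \<in> X"
  shows "x \<ominus>\<^bsub>N\<^esub> y \<in> X"
  using assms submodule_uminus[OF assms(1,3)]
  by (simp add: a_minus_def LinearCombinations.submodule.m_closed)

section \<open>Submodules from homomorphisms, and coordinate ideals\<close>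

context cring
begin

lemma submodule_hom_image:
  assumes "module R P" "module R N" "f \<in> module_hom R P N"
  shows "LinearCombinations.submodule R (f ` carrier P) N"
proof -
  interpret h: mod_hom R P N f
    using assms by (simp add: mod_hom_def mod_hom_axioms_def)
  show ?thesis using h.im_is_submodule by (simp add: h.im_def)
qed

lemma submodule_hom_ker:
  assumes "module R P" "module R N" "f \<in> module_hom R P N"
  shows "LinearCombinations.submodule R {x \<in> carrier P. f x = \<zero>\<^bsub>N\<^esub>} P"
proof -
  interpret h: mod_hom R P N f
    using assms by (simp add: mod_hom_def mod_hom_axioms_def)
  show ?thesis using h.ker_is_submodule by (simp add: h.ker_def)
qed

lemma submodule_fr_mono:
  "a \<le> b \<Longrightarrow> LinearCombinations.submodule R (carrier (fr R a)) (fr R b)"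
  by (auto simp: LinearCombinations.submodule_def module_fr fr_carrier)

lemma submodule_fr_smaller:
  assumes "LinearCombinations.submodule R X (fr R b)" "X \<subseteq> carrier (fr R a)"
  shows "LinearCombinations.submodule R X (fr R a)"
  using assms by (auto simp: LinearCombinations.submodule_def module_fr)

lemma coordinate_ideal:
  assumes "LinearCombinations.submodule R X (fr R a)"
  shows "ideal ((\<lambda>v. v i) ` X) R"
proof -
  interpret X: LinearCombinations.submodule R X "fr R a" by fact
  show ?thesis
  proof (rule idealI[OF ring_axioms])
    show "subgroup ((\<lambda>v. v i) ` X) (add_monoid R)"
    proof (rule add.subgroupI)
      show "(\<lambda>v. v i) ` X \<subseteq> carrier R" using X.subset by (auto simp: fr_carrier)
      show "(\<lambda>v. v i) ` X \<noteq> {}" using X.zero_closed by blast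
      fix x y assume x: "x \<in> (\<lambda>v. v i) ` X" and y: "y \<in> (\<lambda>v. v i) ` X"
      then obtain u v where u: "u \<in> X" "x = u i" and v: "v \<in> X" "y = v i" by blast
      show "x \<oplus> y \<in> (\<lambda>v. v i) ` X" using X.m_closed[OF u(1) v(1)] u v by force
      have "(\<ominus> \<one>) \<odot>\<^bsub>fr R a\<^esub> u \<in> X" using u by (intro X.smult_closed) auto
      moreover have "((\<ominus> \<one>) \<odot>\<^bsub>fr R a\<^esub> u) i = \<ominus> x"
        using u X.subset by (auto simp: fr_carrier l_minus)
      ultimately show "\<ominus> x \<in> (\<lambda>v. v i) ` X" by (metis imageI)
    qed
    fix x r assume "x \<in> (\<lambda>v. v i) ` X" and r: "r \<in> carrier R"
    then obtain u where u: "u \<in> X" "x = u i" by blast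
    have "r \<odot>\<^bsub>fr R a\<^esub> u \<in> X" using u r by (intro X.smult_closed)
    then show "r \<otimes> x \<in> (\<lambda>v. v i) ` X" using u by force
    then show "x \<otimes> r \<in> (\<lambda>v. v i) ` X" using u r X.subset by (auto simp: fr_carrier m_comm)
  qed
qed

end

text \<open>Induction on the rank: generators of the part of \<open>X\<close> with last coordinate
  zero, together with vectors of \<open>X\<close> whose last coordinates generate the ideal of all
  last coordinates of \<open>X\<close>.\<close>

lemma submodule_fr_finitely_generated:
  fixes R (structure)
  assumes "noetherian_ring R" "cring R" "LinearCombinations.submodule R X (fr R a)"
  shows "\<exists>S. finite S \<and> generates R (fr R a) S X"
  using assms(3)
proof (induction a arbitrary: X)
  case 0
  interpret cring R by fact
  interpret X: LinearCombinations.submodule R X "fr R 0" by fact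
  have "x = \<zero>\<^bsub>fr R 0\<^esub>" if "x \<in> X" for x
    using that X.subset by (auto simp: fr_carrier intro!: ext)
  then have "generates R (fr R 0) {} X"
    unfolding generates_def using LinearCombinations.submodule.zero_closed by blast
  then show ?case by blast
next
  case (Suc a)
  interpret cring R by fact
  interpret X: LinearCombinations.submodule R X "fr R (Suc a)" by fact
  interpret F: module R "fr R (Suc a)" by (rule module_fr)
  let ?X0 = "X \<inter> carrier (fr R a)"
  have "LinearCombinations.submodule R ?X0 (fr R (Suc a))"
    by (intro submodule_Int Suc.prems submodule_fr_mono) simp
  then have "LinearCombinations.submodule R ?X0 (fr R a)"
    by (rule submodule_fr_smaller) blast
  then obtain S0 where S0: "finite S0" "generates R (fr R a) S0 ?X0"
    using Suc.IH by blast
  have "ideal ((\<lambda>v. v a) ` X) R" by (rule coordinate_ideal[OF Suc.prems])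
  from noetherian_ring.finetely_gen[OF assms(1) this]
  obtain A where A: "A \<subseteq> carrier R" "finite A" "(\<lambda>v. v a) ` X = Idl\<^bsub>R\<^esub> A" by blast
  have "A \<subseteq> (\<lambda>v. v a) ` X" using A genideal_self by blast
  then obtain T where T: "T \<subseteq> X" "finite T" "A = (\<lambda>v. v a) ` T"
    using finite_subset_image[OF A(2)] by metis
  have "generates R (fr R (Suc a)) (S0 \<union> T) X"
    unfolding generates_def
  proof (intro conjI allI impI subsetI)
    show "x \<in> X" if "x \<in> S0 \<union> T" for x
      using that T S0 by (auto simp: generates_def)
    fix Y x
    assume Y: "LinearCombinations.submodule R Y (fr R (Suc a))" and sub: "S0 \<union> T \<subseteq> Y" and x: "x \<in> X"
    interpret Y: LinearCombinations.submodule R Y "fr R (Suc a)" by fact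
    have "LinearCombinations.submodule R (Y \<inter> carrier (fr R a)) (fr R (Suc a))"
      by (intro submodule_Int Y submodule_fr_mono) simp
    then have "LinearCombinations.submodule R (Y \<inter> carrier (fr R a)) (fr R a)"
      by (rule submodule_fr_smaller) blast
    then have X0Y: "?X0 \<subseteq> Y"
      using S0(2) sub unfolding generates_def by blast
    \<comment> \<open>Intersecting with \<open>X\<close> matters: the vector \<open>y\<close>
      obtained below lies in \<open>X\<close> as well as in \<open>Y\<close>, so that
      \<open>x\<close> minus \<open>y\<close> is an element of \<open>X\<close> with last coordinate
      zero and hence lies in \<open>?X0\<close>.\<close>
    have "A \<subseteq> (\<lambda>v. v a) ` (Y \<inter> X)" using T sub by blast
    then have "(\<lambda>v. v a) ` X \<subseteq> (\<lambda>v. v a) ` (Y \<inter> X)"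
      unfolding A(3) by (intro genideal_minimal coordinate_ideal[where a = "Suc a"] submodule_Int Y Suc.prems)
    then have "x a \<in> (\<lambda>v. v a) ` (Y \<inter> X)" using x by blast
    then obtain y where y: "y \<in> Y" "y \<in> X" "y a = x a" by auto
    have xy: "x \<in> carrier (fr R (Suc a))" "y \<in> carrier (fr R (Suc a))"
      using x y X.subset by auto
    let ?d = "x \<ominus>\<^bsub>fr R (Suc a)\<^esub> y"
    have d: "?d \<in> X" by (intro submodule_minus[OF Suc.prems] x y)
    have "x = ?d \<oplus>\<^bsub>fr R (Suc a)\<^esub> y"
      using xy by (simp add: a_minus_def F.M.a_assoc F.M.l_neg del: fr_simps)
    then have "x i = ?d i \<oplus> y i" for i by (metis fr_simps(2))
    then have "y a = ?d a \<oplus> y a" using y(3) by metis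
    moreover have "?d a \<in> carrier R" "y a \<in> carrier R"
      using d X.subset xy by (auto simp: fr_carrier)
    ultimately have "?d a = \<zero>" by (metis add.r_cancel_one')
    then have "?d \<in> ?X0" using d X.subset
      by (auto simp: fr_carrier) (metis Suc_leI le_neq_implies_less subsetD fr_carrier)
    then have "?d \<in> Y" using X0Y by blast
    then have "?d \<oplus>\<^bsub>fr R (Suc a)\<^esub> y \<in> Y" using y by (intro Y.m_closed)
    then show "x \<in> Y" using \<open>x = _\<close> by simp
  qed
  then show ?case using S0 T by blast
qed

section \<open>Covers by free modules and minimal covers\<close>

lemma fg_module_generates:
  assumes "fg_module R M"
  shows "\<exists>S. finite S \<and> generates R M S (carrier M)"
proof -
  from assms interpret M: module R M by (simp add: fg_module_def)
  from assms obtain S where "S \<subseteq> carrier M" "finite S" "M.span S = carrier M"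
    by (auto simp: fg_module_def)
  then have "generates R M S (carrier M)"
    using M.span_is_subset unfolding generates_def by blast
  then show ?thesis using \<open>finite S\<close> by blast
qed

lemma (in cring) lin_image_generates:
  assumes N: "module R N" and X: "LinearCombinations.submodule R X N"
    and gen: "generates R N (y ` {..<a}) X"
  shows "lin N y a \<in> module_hom R (fr R a) N" "lin N y a ` carrier (fr R a) = X"
proof -
  interpret X: LinearCombinations.submodule R X N by fact
  have yX: "y i \<in> X" if "i < a" for i
    using gen that by (auto simp: generates_def)
  then have yN: "y i \<in> carrier N" if "i < a" for i using X.subset that by blast
  show p: "lin N y a \<in> module_hom R (fr R a) N" using lin_hom[OF N] yN by blast
  have "y ` {..<a} \<subseteq> lin N y a ` carrier (fr R a)"
  proof
    fix s assume "s \<in> y ` {..<a}"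
    then obtain i where i: "i < a" "s = y i" by blast
    then show "s \<in> lin N y a ` carrier (fr R a)"
      using lin_unitv[OF N, of a y i] yN unitv_closed[of i a] by (metis imageI)
  qed
  then have "X \<subseteq> lin N y a ` carrier (fr R a)"
    using gen submodule_hom_image[OF module_fr N p] unfolding generates_def by blast
  moreover have "lin N y a ` carrier (fr R a) \<subseteq> X"
    using yX by (auto simp: fr_carrier intro!: lin_in_submodule[OF N X])
  ultimately show "lin N y a ` carrier (fr R a) = X" by blast
qed

text \<open>Take a generating set of least cardinality. A relation with a coefficient outside
  \<open>m\<close> has a unit there and would express one generator by the others, contradicting the
  choice.\<close>

lemma minimal_cover:
  fixes R (structure)
  assumes R: "noetherian_ring R" "local_ring R m" and N: "module R N"
    and X: "LinearCombinations.submodule R X N" and fg: "finite S" "generates R N S X"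
  shows "\<exists>a. \<exists>p\<in>module_hom R (fr R a) N. p ` carrier (fr R a) = X \<and>
    (\<forall>z\<in>carrier (fr R a). p z = \<zero>\<^bsub>N\<^esub> \<longrightarrow> (\<forall>i. z i \<in> m))"
proof -
  interpret cring R using R(2) by (simp add: local_ring_def)
  interpret m: ideal m R using R(2) by (simp add: local_ring_def maximalideal_def)
  interpret N: module R N by fact
  interpret X: LinearCombinations.submodule R X N by fact
  let ?Q = "\<lambda>S. finite S \<and> generates R N S X"
  obtain S where S: "finite S" "generates R N S X"
    and least: "\<And>T. ?Q T \<Longrightarrow> card S \<le> card T"
    using ex_has_least_nat[of ?Q _ card] fg by metis
  obtain y where y: "bij_betw y {..<card S} S"
    using ex_bij_betw_nat_finite[OF S(1)] by (auto simp: lessThan_atLeast0)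
  have yX: "y i \<in> X" if "i < card S" for i
    using bij_betwE[OF y] S that by (auto simp: generates_def)
  then have yN: "y i \<in> carrier N" if "i < card S" for i using X.subset that by blast
  let ?p = "lin N y (card S)"
  have "generates R N (y ` {..<card S}) X" using S(2) y by (simp add: bij_betw_def)
  note p = lin_image_generates[OF N X this]
  have min: "z i \<in> m" if z: "z \<in> carrier (fr R (card S))" and pz: "?p z = \<zero>\<^bsub>N\<^esub>" for z i
  proof (rule ccontr)
    assume zi: "z i \<notin> m"
    have zR: "z j \<in> carrier R" for j using z by (simp add: fr_carrier)
    have i: "i < card S" using z zi m.zero_closed by (metis fr_carrier not_le)
    have u: "z i \<in> Units R" using local_ring_Units[OF R zR zi] .
    have iS: "y i \<in> S" using y i by (auto simp: bij_betw_def)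
    have "generates R N (S - {y i}) X"
      unfolding generates_def
    proof (intro conjI allI impI)
      show "S - {y i} \<subseteq> X" using S by (auto simp: generates_def)
      fix Y assume Y: "LinearCombinations.submodule R Y N" and sub: "S - {y i} \<subseteq> Y"
      interpret Y: LinearCombinations.submodule R Y N by fact
      have yY: "y j \<in> Y" if "j < card S" "j \<noteq> i" for j
      proof -
        have "y j \<in> S" using y that by (auto simp: bij_betw_def)
        moreover have "y j \<noteq> y i"
          using y that i inj_onD[of y "{..<card S}" j i] by (auto simp: bij_betw_def)
        ultimately show ?thesis using sub by blast
      qed
      \<comment> \<open>Removes the i-th term of the relation. Zeroing the generator
        \<open>y i\<close> too leaves the value unchanged and makes every generator used lie in
        \<open>Y\<close>, although \<open>y i\<close> is not yet known to.\<close>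
      let ?z = "\<lambda>j. if j = i then \<zero> else z j"
      let ?y = "\<lambda>j. if j = i then \<zero>\<^bsub>N\<^esub> else y j"
      have split: "z = z i \<odot>\<^bsub>fr R (card S)\<^esub> unitv R i \<oplus>\<^bsub>fr R (card S)\<^esub> ?z"
        using zR by (intro ext) (simp add: unitv_def)
      have zc: "?z \<in> carrier (fr R (card S))" using z by (auto simp: fr_carrier)
      interpret F: module R "fr R (card S)" by (rule module_fr)
      interpret h: mod_hom R "fr R (card S)" N ?p by unfold_locales (rule p(1))
      have "?p z = ?p (z i \<odot>\<^bsub>fr R (card S)\<^esub> unitv R i \<oplus>\<^bsub>fr R (card S)\<^esub> ?z)"
        using split by (rule arg_cong)
      also have "\<dots> = ?p (z i \<odot>\<^bsub>fr R (card S)\<^esub> unitv R i) \<oplus>\<^bsub>N\<^esub> ?p ?z"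
        by (rule h.f_add[OF F.smult_closed[OF zR unitv_closed[OF i]] zc])
      also have "?p (z i \<odot>\<^bsub>fr R (card S)\<^esub> unitv R i) = z i \<odot>\<^bsub>N\<^esub> ?p (unitv R i)"
        by (rule h.f_smult[OF zR unitv_closed[OF i]])
      also have "?p (unitv R i) = y i" by (rule lin_unitv[OF N yN i])
      finally have "?p z = z i \<odot>\<^bsub>N\<^esub> y i \<oplus>\<^bsub>N\<^esub> ?p ?z" .
      moreover have "?p ?z = lin N ?y (card S) ?z"
        unfolding lin_def using yN zR by (intro N.M.finsum_cong') auto
      moreover have "lin N ?y (card S) ?z \<in> Y"
        using yY zR by (intro lin_in_submodule[OF N Y]) auto
      ultimately have *: "z i \<odot>\<^bsub>N\<^esub> y i \<oplus>\<^bsub>N\<^esub> ?p ?z = \<zero>\<^bsub>N\<^esub>" and pY: "?p ?z \<in> Y"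
        using pz by auto
      have "z i \<odot>\<^bsub>N\<^esub> y i = \<ominus>\<^bsub>N\<^esub> ?p ?z"
        using * yN[OF i] zR h.f_im[OF zc] by (intro N.M.minus_equality[symmetric]) auto
      then have "z i \<odot>\<^bsub>N\<^esub> y i \<in> Y" using submodule_uminus[OF Y pY] by simp
      then have "inv z i \<odot>\<^bsub>N\<^esub> (z i \<odot>\<^bsub>N\<^esub> y i) \<in> Y" using u by (rule_tac Y.smult_closed) auto
      also have "inv z i \<odot>\<^bsub>N\<^esub> (z i \<odot>\<^bsub>N\<^esub> y i) = y i"
        using u yN[OF i] zR by (subst N.smult_assoc1[symmetric]) (auto simp: Units_l_inv)
      finally have "S \<subseteq> Y" using sub by blast
      then show "X \<subseteq> Y" using S(2) Y by (auto simp: generates_def)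
    qed
    then have "card S \<le> card (S - {y i})" using least S(1) by simp
    then show False using iS S(1) by (metis card_Diff1_less not_le)
  qed
  show ?thesis using p min by blast
qed

section \<open>Finitely generated free modules compared with \<open>R^a\<close>\<close>

context cring
begin

lemma hom_fr_comp_unitv:
  assumes "module R N" "p \<in> module_hom R (fr R a) N" "i < a"
  shows "p (unitv R i) \<in> carrier N"
  using assms unitv_closed unfolding module_hom_def by blast

lemma fg_module_if_surj:
  assumes N: "module R N" and p: "p \<in> module_hom R (fr R a) N" "p ` carrier (fr R a) = carrier N"
  shows "fg_module R N"
proof -
  interpret N: module R N by fact
  let ?S = "(\<lambda>i. p (unitv R i)) ` {..<a}"
  have S: "?S \<subseteq> carrier N" using hom_fr_comp_unitv[OF N p(1)] by blast
  have span: "LinearCombinations.submodule R (N.span ?S) N" by (rule N.span_is_submodule[OF S])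
  have "carrier N \<subseteq> N.span ?S"
  proof
    fix x assume "x \<in> carrier N"
    then obtain v where v: "v \<in> carrier (fr R a)" "x = p v" using p(2) by blast
    show "x \<in> N.span ?S"
      unfolding v(2) hom_fr_eq_lin[OF N p(1) v(1)]
      using v N.in_own_span[OF S] by (intro lin_in_submodule[OF N span]) (auto simp: fr_carrier)
  qed
  then have "N.span ?S = carrier N" using N.span_is_subset2[OF S] by blast
  then show ?thesis using S N unfolding fg_module_def by blast
qed

lemma lincomb_image_eq_lin:
  assumes N: "module R N" and y: "inj_on y {..<a}" "y ` {..<a} \<subseteq> carrier N"
    and c: "c \<in> y ` {..<a} \<rightarrow> carrier R"
  shows "LinearCombinations.module.lincomb N c (y ` {..<a}) = lin N y a (\<lambda>i. if i < a then c (y i) else \<zero>)"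
proof -
  interpret N: module R N by fact
  have "N.lincomb c (y ` {..<a}) = (\<Oplus>\<^bsub>N\<^esub>i\<in>{..<a}. c (y i) \<odot>\<^bsub>N\<^esub> y i)"
    unfolding N.lincomb_def using y c
    by (intro N.M.add.finprod_reindex) auto
  also have "\<dots> = lin N y a (\<lambda>i. if i < a then c (y i) else \<zero>)"
    unfolding lin_def using y c
    by (intro N.M.finsum_cong') (auto simp: Pi_iff image_subset_iff)
  finally show ?thesis .
qed

text \<open>The images of the unit vectors are a basis. Since a basis is a set, they must be
  distinct for relations among them to be read as vectors of \<open>R^a\<close>; a coincidence would
  put a difference of two unit vectors into the kernel, which \<open>\<one> \<noteq> \<zero>\<close>
  excludes.\<close>

lemma free_module_if_bij:
  assumes one: "\<one> \<noteq> \<zero>"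
    and N: "module R N" and p: "p \<in> module_hom R (fr R a) N" "p ` carrier (fr R a) = carrier N"
    and ker: "\<And>v. v \<in> carrier (fr R a) \<Longrightarrow> p v = \<zero>\<^bsub>N\<^esub> \<Longrightarrow> v = (\<lambda>i. \<zero>)"
  shows "free_module R N"
proof -
  interpret N: module R N by fact
  interpret F: module R "fr R a" by (rule module_fr)
  interpret h: mod_hom R "fr R a" N p by unfold_locales (rule p(1))
  let ?y = "\<lambda>i. p (unitv R i)"
  let ?B = "?y ` {..<a}"
  have B: "?B \<subseteq> carrier N" using hom_fr_comp_unitv[OF N p(1)] by blast
  have inj: "inj_on ?y {..<a}"
  proof (rule inj_onI, rule ccontr)
    fix i j assume i: "i \<in> {..<a}" and j: "j \<in> {..<a}" and eq: "?y i = ?y j" and "i \<noteq> j"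
    have u: "unitv R i \<in> carrier (fr R a)" "unitv R j \<in> carrier (fr R a)"
      using i j by (auto intro: unitv_closed)
    let ?d = "unitv R i \<oplus>\<^bsub>fr R a\<^esub> (\<ominus> \<one>) \<odot>\<^bsub>fr R a\<^esub> unitv R j"
    have d: "?d \<in> carrier (fr R a)"
      using u by (intro F.M.a_closed F.smult_closed) auto
    have "p ?d = ?y i \<oplus>\<^bsub>N\<^esub> (\<ominus> \<one>) \<odot>\<^bsub>N\<^esub> ?y j"
      using h.f_add[OF u(1) F.smult_closed[OF _ u(2)], of "\<ominus> \<one>"] h.f_smult[OF _ u(2), of "\<ominus> \<one>"]
      by (simp del: fr_simps)
    also have "\<dots> = \<zero>\<^bsub>N\<^esub>"
      using eq h.f_im[OF u(2)] by (simp add: N.smult_minus_1 N.M.r_neg)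
    finally have "?d = (\<lambda>i. \<zero>)" using ker[OF d] by blast
    then have "?d i = \<zero>" by metis
    then show False using \<open>i \<noteq> j\<close> one by (simp add: unitv_def)
  qed
  have ext: "(\<lambda>i. if i < a then c (?y i) else \<zero>) \<in> carrier (fr R a)"
    if "c \<in> ?B \<rightarrow> carrier R" for c
    using that by (auto simp: fr_carrier)
  have lincomb: "N.lincomb c ?B = p (\<lambda>i. if i < a then c (?y i) else \<zero>)"
    if c: "c \<in> ?B \<rightarrow> carrier R" for c
    using lincomb_image_eq_lin[OF N inj B c] hom_fr_eq_lin[OF N p(1) ext[OF c]] by simp
  have "N.lin_indpt ?B"
  proof (rule N.finite_lin_indpt2)
    fix c assume c: "c \<in> ?B \<rightarrow> carrier R" and 0: "N.lincomb c ?B = \<zero>\<^bsub>N\<^esub>"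
    have "(\<lambda>i. if i < a then c (?y i) else \<zero>) = (\<lambda>i. \<zero>)"
      using ker[OF ext[OF c]] 0 lincomb[OF c] by simp
    then have "c (?y i) = \<zero>" if "i < a" for i using that by (meson)
    then show "\<forall>v\<in>?B. c v = \<zero>" by blast
  qed (use B in auto)
  moreover have "N.span ?B = carrier N"
  proof
    show "N.span ?B \<subseteq> carrier N" by (rule N.span_is_subset2[OF B])
    show "carrier N \<subseteq> N.span ?B"
    proof
      fix x assume "x \<in> carrier N"
      then obtain v where v: "v \<in> carrier (fr R a)" "x = p v" using p(2) by blast
      show "x \<in> N.span ?B"
        unfolding v(2) hom_fr_eq_lin[OF N p(1) v(1)]
        using v N.in_own_span[OF B]
        by (intro lin_in_submodule[OF N N.span_is_submodule[OF B]]) (auto simp: fr_carrier)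
    qed
  qed
  ultimately show ?thesis using B N unfolding free_module_def by blast
qed

lemma fr_fg_free:
  assumes "\<one> \<noteq> \<zero>"
  shows "fg_module R (fr R a)" "free_module R (fr R a)"
proof -
  have id: "(\<lambda>v. v) \<in> module_hom R (fr R a) (fr R a)" by (simp add: module_hom_def)
  show "fg_module R (fr R a)" by (rule fg_module_if_surj[OF module_fr id]) simp
  show "free_module R (fr R a)" by (rule free_module_if_bij[OF assms module_fr id]) auto
qed

text \<open>Stated as a retraction, the form in which lifting passes from \<open>R^a\<close> to
  \<open>P\<close>; the map \<open>?f\<close> of the proof is in fact injective.\<close>

lemma fg_free_iso_fr:
  assumes one: "\<one> \<noteq> \<zero>" and fg: "fg_module R P" and free: "free_module R P"
  shows "\<exists>a. \<exists>f\<in>module_hom R (fr R a) P. \<exists>g\<in>module_hom R P (fr R a). \<forall>x\<in>carrier P. f (g x) = x"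
proof -
  from fg interpret P: module R P by (simp add: fg_module_def)
  from fg obtain S where S: "S \<subseteq> carrier P" "finite S" "P.span S = carrier P"
    by (auto simp: fg_module_def)
  from free obtain B where B: "B \<subseteq> carrier P" "P.lin_indpt B" "P.span B = carrier P"
    by (auto simp: free_module_def)
  \<comment> \<open>A priori \<open>B\<close> may be infinite. Each of the finitely many generators
    uses finitely many basis vectors; the resulting finite subset \<open>?C\<close> already spans
    and stays independent.\<close>
  have "\<forall>s\<in>S. \<exists>A. finite A \<and> A \<subseteq> B \<and> s \<in> P.span A"
  proof
    fix s assume "s \<in> S"
    then have "s \<in> P.span B" using S B by blast
    then obtain c A where "s = P.lincomb c A" "finite A" "A \<subseteq> B" "c \<in> A \<rightarrow> carrier R"
      unfolding P.span_def by blast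
    then show "\<exists>A. finite A \<and> A \<subseteq> B \<and> s \<in> P.span A"
      unfolding P.span_def by blast
  qed
  then obtain A where A: "\<And>s. s \<in> S \<Longrightarrow> finite (A s) \<and> A s \<subseteq> B \<and> s \<in> P.span (A s)"
    by metis
  let ?C = "\<Union>s\<in>S. A s"
  have C: "finite ?C" "?C \<subseteq> B" using A S by blast+
  then have CP: "?C \<subseteq> carrier P" using B by blast
  have "S \<subseteq> P.span ?C"
    using A P.span_is_monotone[of "A _" ?C] by blast
  then have spanC: "P.span ?C = carrier P"
    using P.span_is_subset[OF _ P.span_is_submodule[OF CP]] S P.span_is_subset2[OF CP] by blast
  have indC: "P.lin_indpt ?C" using P.subset_li_is_li[OF B(2) C(2)] .
  obtain y where y: "bij_betw y {..<card ?C} ?C"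
    using ex_bij_betw_nat_finite[OF C(1)] by (auto simp: lessThan_atLeast0)
  define a where "a = card ?C"
  have yC: "y ` {..<a} = ?C" and inj: "inj_on y {..<a}"
    using y by (auto simp: bij_betw_def a_def)
  have yP: "y ` {..<a} \<subseteq> carrier P" using yC CP by simp
  let ?f = "lin P y a"
  have f: "?f \<in> module_hom R (fr R a) P" using yP by (intro lin_hom[OF P.module_axioms]) blast
  interpret F: module R "fr R a" by (rule module_fr)
  interpret h: mod_hom R "fr R a" P ?f by unfold_locales (rule f)
  have "\<exists>v\<in>carrier (fr R a). ?f v = x" if x: "x \<in> carrier P" for x
  proof -
    have "x \<in> P.span ?C" using x spanC by simp
    from P.finite_in_span[OF C(1) CP this]
    obtain c where c: "c \<in> ?C \<rightarrow> carrier R" "P.lincomb c ?C = x" by blast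
    then have "lin P y a (\<lambda>i. if i < a then c (y i) else \<zero>) = x"
      using lincomb_image_eq_lin[OF P.module_axioms inj yP, of c] yC by simp
    moreover have "(\<lambda>i. if i < a then c (y i) else \<zero>) \<in> carrier (fr R a)"
      using c(1) unfolding yC[symmetric] by (auto simp: fr_carrier)
    ultimately show ?thesis by blast
  qed
  then obtain g where g: "\<And>x. x \<in> carrier P \<Longrightarrow> g x \<in> carrier (fr R a)"
    and fg: "\<And>x. x \<in> carrier P \<Longrightarrow> ?f (g x) = x" by metis
  have ker: "v = (\<lambda>i. \<zero>)" if v: "v \<in> carrier (fr R a)" and 0: "?f v = \<zero>\<^bsub>P\<^esub>" for v
  proof (rule ccontr)
    assume "v \<noteq> (\<lambda>i. \<zero>)"
    then obtain i where "v i \<noteq> \<zero>" by blast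
    then have i: "i < a" using v by (metis fr_carrier not_le)
    let ?c = "\<lambda>x. v (the_inv_into {..<a} y x)"
    have cy: "?c (y j) = v j" if "j < a" for j
      using that the_inv_into_f_f[OF inj] by simp
    have c: "?c \<in> y ` {..<a} \<rightarrow> carrier R" using v by (auto simp: fr_carrier)
    have "P.lincomb ?c (y ` {..<a}) = lin P y a (\<lambda>i. if i < a then ?c (y i) else \<zero>)"
      by (rule lincomb_image_eq_lin[OF P.module_axioms inj yP c])
    also have "\<dots> = ?f v"
      using yP v cy by (intro lin_cong[OF P.module_axioms]) (auto simp: fr_carrier)
    finally have "P.lincomb ?c (y ` {..<a}) = \<zero>\<^bsub>P\<^esub>" using 0 by simp
    then have "P.lin_dep (y ` {..<a})"
      using c i cy[OF i] \<open>v i \<noteq> \<zero>\<close>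
      by (intro P.lin_dep_crit[of "y ` {..<a}" _ ?c "y i"]) auto
    then show False using indC yC by simp
  qed
  have inj_f: "u = v" if "u \<in> carrier (fr R a)" "v \<in> carrier (fr R a)" "?f u = ?f v" for u v
  proof -
    have "?f (u \<ominus>\<^bsub>fr R a\<^esub> v) = \<zero>\<^bsub>P\<^esub>"
      using h.f_minus[OF that(1,2)] that h.f_im[OF that(2)] by (simp add: P.M.r_neg a_minus_def)
    then have "u \<ominus>\<^bsub>fr R a\<^esub> v = \<zero>\<^bsub>fr R a\<^esub>" using ker[OF F.M.minus_closed[OF that(1,2)]] by simp
    moreover have "u = (u \<ominus>\<^bsub>fr R a\<^esub> v) \<oplus>\<^bsub>fr R a\<^esub> v"
      using that by (simp add: a_minus_def F.M.a_assoc F.M.l_neg del: fr_simps)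
    ultimately show ?thesis using F.M.l_zero[OF that(2)] by metis
  qed
  \<comment> \<open>\<open>g\<close> is a mere choice of preimages; injectivity of \<open>?f\<close>
    makes it linear.\<close>
  have "g \<in> module_hom R P (fr R a)"
    unfolding module_hom_def
  proof (intro CollectI conjI allI impI funcsetI)
    show "g x \<in> carrier (fr R a)" if "x \<in> carrier P" for x using g that .
    show "g (x \<oplus>\<^bsub>P\<^esub> z) = g x \<oplus>\<^bsub>fr R a\<^esub> g z" if "x \<in> carrier P \<and> z \<in> carrier P" for x z
      using that g fg h.f_add[of "g x" "g z"] F.M.a_closed[of "g x" "g z"]
      by (intro inj_f) (auto simp del: fr_simps)
    show "g (r \<odot>\<^bsub>P\<^esub> x) = r \<odot>\<^bsub>fr R a\<^esub> g x" if "r \<in> carrier R \<and> x \<in> carrier P" for r x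
      using that g fg h.f_smult[of r "g x"] F.smult_closed[of r "g x"]
      by (intro inj_f) (auto simp del: fr_simps)
  qed
  then show ?thesis using f fg by blast
qed

text \<open>Lift \<open>f\<close> composed with \<open>s\<close> on \<open>R^a\<close>, then
  precompose the lift with the section \<open>t\<close>.\<close>

lemma free_lift:
  assumes one: "\<one> \<noteq> \<zero>" and P: "fg_module R P" "free_module R P"
    and N: "module R N" and Q: "module R Q" and q: "q \<in> module_hom R Q N"
    and f: "f \<in> module_hom R P N" and sub: "f ` carrier P \<subseteq> q ` carrier Q"
  shows "\<exists>g \<in> module_hom R P Q. \<forall>v\<in>carrier P. q (g v) = f v"
proof -
  obtain a s t where s: "s \<in> module_hom R (fr R a) P" and t: "t \<in> module_hom R P (fr R a)"
    and st: "\<And>x. x \<in> carrier P \<Longrightarrow> s (t x) = x"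
    using fg_free_iso_fr[OF one P] by blast
  have fs: "(\<lambda>v. f (s v)) \<in> module_hom R (fr R a) N"
    using s f unfolding module_hom_def by (auto simp: Pi_iff simp del: fr_simps)
  have "(\<lambda>v. f (s v)) ` carrier (fr R a) \<subseteq> q ` carrier Q"
    using s sub unfolding module_hom_def by blast
  from fr_lift[OF N Q q fs this]
  obtain g where g: "g \<in> module_hom R (fr R a) Q"
    and qg: "\<And>v. v \<in> carrier (fr R a) \<Longrightarrow> q (g v) = f (s v)"
    by (elim bexE) blast
  have "(\<lambda>v. g (t v)) \<in> module_hom R P Q"
    using t g unfolding module_hom_def by (auto simp: Pi_iff simp del: fr_simps)
  moreover have "q (g (t v)) = f v" if "v \<in> carrier P" for v
    using qg[of "t v"] st[OF that] t that unfolding module_hom_def by auto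
  ultimately show ?thesis by (intro bexI[of _ "\<lambda>v. g (t v)"]) auto
qed

end

section \<open>Existence of resolutions\<close>

lemma (in cring) cover_exists:
  assumes N: "module R N" and X: "LinearCombinations.submodule R X N"
    and S: "finite S" "generates R N S X"
  shows "\<exists>b p. p \<in> module_hom R (fr R b) N \<and> p ` carrier (fr R b) = X"
proof -
  obtain y where "bij_betw y {..<card S} S"
    using ex_bij_betw_nat_finite[OF S(1)] by (auto simp: lessThan_atLeast0)
  then have "generates R N (y ` {..<card S}) X" using S(2) by (simp add: bij_betw_def)
  from lin_image_generates[OF N X this] show ?thesis by blast
qed

lemma fg_free_resolution_exists:
  fixes R (structure) and M :: "('a, 'm, 'z) module_scheme"
  assumes R: "noetherian_ring R" "cring R" and one: "\<one> \<noteq> \<zero>" and fg: "fg_module R M"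
  shows "\<exists>(F :: nat \<Rightarrow> ('a, nat \<Rightarrow> 'a) module) d e. fg_free_resolution R M F d e"
proof -
  interpret cring R by fact
  \<comment> \<open>A state \<open>s\<close> is a rank together with a submodule of the free module
    of that rank, still to be covered. \<open>?cov s t\<close> says that \<open>t\<close>, a map
    with its source rank, covers it.\<close>
  let ?sub = "\<lambda>s. LinearCombinations.submodule R (snd s) (fr R (fst s))"
  let ?cov = "\<lambda>s t. fst t \<in> module_hom R (fr R (snd t)) (fr R (fst s)) \<and>
    fst t ` carrier (fr R (snd t)) = snd s"
  have "\<exists>t. ?cov s t" if "?sub s" for s
  proof -
    obtain S where "finite S" "generates R (fr R (fst s)) S (snd s)"
      using submodule_fr_finitely_generated[OF R \<open>?sub s\<close>] by blast
    from cover_exists[OF module_fr \<open>?sub s\<close> this] show ?thesis by auto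
  qed
  then have "\<forall>s. \<exists>t. ?sub s \<longrightarrow> ?cov s t" by blast
  then obtain c where c: "\<And>s. ?sub s \<Longrightarrow> ?cov s (c s)" by metis
  \<comment> \<open>Replaces the submodule by the kernel of its chosen cover. Thus
    \<open>d i\<close> covers the submodule in \<open>st i\<close>, whose description as a kernel is
    exactness at \<open>F i\<close>.\<close>
  define nxt where "nxt s = (snd (c s),
    {v \<in> carrier (fr R (snd (c s))). fst (c s) v = \<zero>\<^bsub>fr R (fst s)\<^esub>})" for s
  have nxt: "?sub (nxt s)" if "?sub s" for s
    using submodule_hom_ker[OF module_fr module_fr conjunct1[OF c[OF that]]] by (simp add: nxt_def)
  from fg interpret M: module R M by (simp add: fg_module_def)
  have M: "LinearCombinations.submodule R (carrier M) M"
    by (auto simp: LinearCombinations.submodule_def M.module_axioms)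
  obtain S where "finite S" "generates R M S (carrier M)"
    using fg_module_generates[OF fg] by blast
  from cover_exists[OF M.module_axioms M this] obtain b e
    where e: "e \<in> module_hom R (fr R b) M" "e ` carrier (fr R b) = carrier M" by blast
  define st where "st = rec_nat (b, {v \<in> carrier (fr R b). e v = \<zero>\<^bsub>M\<^esub>}) (\<lambda>_. nxt)"
  have st_0: "st 0 = (b, {v \<in> carrier (fr R b). e v = \<zero>\<^bsub>M\<^esub>})"
    and st_Suc: "\<And>i. st (Suc i) = nxt (st i)" by (simp_all add: st_def)
  have st: "?sub (st i)" for i
    by (induction i) (simp_all add: st_0 st_Suc nxt submodule_hom_ker[OF module_fr M.module_axioms e(1)])
  define F where "F i = fr R (fst (st i))" for i
  define d where "d i = fst (c (st i))" for i
  have F_Suc: "F (Suc i) = fr R (snd (c (st i)))" for i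
    by (simp add: F_def st_Suc nxt_def)
  have d: "d i \<in> module_hom R (F (Suc i)) (F i)" "d i ` carrier (F (Suc i)) = snd (st i)" for i
    using c[OF st[of i]] by (auto simp: d_def F_Suc) (simp_all add: F_def)
  have "fg_free_resolution R M F d e"
    unfolding fg_free_resolution_def
  proof (intro conjI allI)
    show "fg_module R (F i)" "free_module R (F i)" for i
      unfolding F_def by (rule fr_fg_free[OF one])+
    show "d i \<in> module_hom R (F (Suc i)) (F i)" for i by (rule d)
    show "e \<in> module_hom R (F 0) M" "e ` carrier (F 0) = carrier M"
      using e by (simp_all add: F_def st_0)
    show "d 0 ` carrier (F 1) = {x \<in> carrier (F 0). e x = \<zero>\<^bsub>M\<^esub>}"
      using d(2)[of 0] by (simp add: F_def st_0)
    show "d (Suc i) ` carrier (F (Suc (Suc i))) = {x \<in> carrier (F (Suc i)). d i x = \<zero>\<^bsub>F i\<^esub>}" for i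
      unfolding d(2) by (simp add: F_Suc d_def st_Suc nxt_def F_def)
  qed
  then show ?thesis by blast
qed

section \<open>Comparison of syzygies\<close>

lemma hom_comp:
  assumes "f \<in> module_hom R L N" "g \<in> module_hom R N Q"
  shows "(\<lambda>x. g (f x)) \<in> module_hom R L Q"
  using assms unfolding module_hom_def by (auto simp: Pi_iff)

lemma hom_add:
  assumes "module R L" "module R N" "f \<in> module_hom R L N" "g \<in> module_hom R L N"
  shows "(\<lambda>x. f x \<oplus>\<^bsub>N\<^esub> g x) \<in> module_hom R L N"
proof -
  interpret L: module R L by fact
  interpret N: module R N by fact
  have c: "f x \<in> carrier N" "g x \<in> carrier N" if "x \<in> carrier L" for x
    using assms(3,4) that unfolding module_hom_def by auto
  show ?thesis
    unfolding module_hom_def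
  proof (intro CollectI conjI allI impI funcsetI)
    show "f x \<oplus>\<^bsub>N\<^esub> g x \<in> carrier N" if "x \<in> carrier L" for x using c that by simp
    show "f (x \<oplus>\<^bsub>L\<^esub> y) \<oplus>\<^bsub>N\<^esub> g (x \<oplus>\<^bsub>L\<^esub> y) = f x \<oplus>\<^bsub>N\<^esub> g x \<oplus>\<^bsub>N\<^esub> (f y \<oplus>\<^bsub>N\<^esub> g y)"
      if "x \<in> carrier L \<and> y \<in> carrier L" for x y
      using c that module_hom_add[OF assms(3)] module_hom_add[OF assms(4)]
      by (simp add: N.M.a_ac)
    show "f (r \<odot>\<^bsub>L\<^esub> x) \<oplus>\<^bsub>N\<^esub> g (r \<odot>\<^bsub>L\<^esub> x) = r \<odot>\<^bsub>N\<^esub> (f x \<oplus>\<^bsub>N\<^esub> g x)"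
      if "r \<in> carrier R \<and> x \<in> carrier L" for r x
      using c that module_hom_smult[OF assms(3)] module_hom_smult[OF assms(4)]
      by (simp add: N.smult_r_distr)
  qed
qed

lemma hom_uminus:
  assumes "module R L" "module R N" "f \<in> module_hom R L N"
  shows "(\<lambda>x. \<ominus>\<^bsub>N\<^esub> f x) \<in> module_hom R L N"
proof -
  interpret L: module R L by fact
  interpret N: module R N by fact
  have c: "f x \<in> carrier N" if "x \<in> carrier L" for x
    using assms(3) that unfolding module_hom_def by auto
  show ?thesis
    unfolding module_hom_def
  proof (intro CollectI conjI allI impI funcsetI)
    show "\<ominus>\<^bsub>N\<^esub> f x \<in> carrier N" if "x \<in> carrier L" for x using c that by simp
    show "\<ominus>\<^bsub>N\<^esub> f (x \<oplus>\<^bsub>L\<^esub> y) = \<ominus>\<^bsub>N\<^esub> f x \<oplus>\<^bsub>N\<^esub> \<ominus>\<^bsub>N\<^esub> f y"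
      if "x \<in> carrier L \<and> y \<in> carrier L" for x y
      using c that module_hom_add[OF assms(3)] by (simp add: N.M.minus_add)
    show "\<ominus>\<^bsub>N\<^esub> f (r \<odot>\<^bsub>L\<^esub> x) = r \<odot>\<^bsub>N\<^esub> \<ominus>\<^bsub>N\<^esub> f x"
      if "r \<in> carrier R \<and> x \<in> carrier L" for r x
      using c that module_hom_smult[OF assms(3)] by (simp add: N.smult_r_minus)
  qed
qed

lemma hom_id: "(\<lambda>x. x) \<in> module_hom R L L"
  by (simp add: module_hom_def)

lemma hom_restrict:
  "f \<in> module_hom R L N \<Longrightarrow> X \<subseteq> carrier L \<Longrightarrow> f \<in> module_hom R (L\<lparr>carrier := X\<rparr>) N"
  by (auto simp: module_hom_def subset_iff)

lemma hom_corestrict: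
  "f \<in> module_hom R L N \<Longrightarrow> f \<in> module_hom R L (N\<lparr>carrier := f ` carrier L\<rparr>)"
  by (auto simp: module_hom_def)

text \<open>
  For \<open>X \<subseteq> P\<close> and \<open>Y \<subseteq> Q\<close>: the identity of \<open>X\<close> is the sum of a map that factors through \<open>Y\<close> and
  one that factors through the inclusion \<open>X \<rightarrow> P\<close>, so \<open>X\<close> is a direct summand of \<open>Y \<oplus> P\<close>.
\<close>

definition stable_retract ::
    "('a, 'r) ring_scheme \<Rightarrow> ('a, 'p, 'y) module_scheme \<Rightarrow> 'p set \<Rightarrow>
     ('a, 'q, 'z) module_scheme \<Rightarrow> 'q set \<Rightarrow> bool"
  where "stable_retract R P X Q Y \<longleftrightarrow>
    (\<exists>f\<in>module_hom R (Q\<lparr>carrier := Y\<rparr>) P. \<exists>g\<in>module_hom R P Q. \<exists>h\<in>module_hom R P P.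
       f ` Y \<subseteq> X \<and> g ` X \<subseteq> Y \<and> h ` carrier P \<subseteq> X \<and> (\<forall>x\<in>X. x = f (g x) \<oplus>\<^bsub>P\<^esub> h x))"

text \<open>For free \<open>P\<close> and a submodule \<open>X\<close> this says that the first Ext
  of \<open>P / X\<close> with values in \<open>R\<close> vanishes. It mentions no resolution, so it
  can be carried from one resolution to another.\<close>

definition homs_extend ::
    "('a, 'r) ring_scheme \<Rightarrow> ('a, 'p, 'y) module_scheme \<Rightarrow> 'p set \<Rightarrow> bool"
  where "homs_extend R P X \<longleftrightarrow>
    (\<forall>\<phi>\<in>module_hom R (P\<lparr>carrier := X\<rparr>) (ring_module R).
       \<exists>\<psi>\<in>module_hom R P (ring_module R). \<forall>x\<in>X. \<psi> x = \<phi> x)"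

lemma (in cring) module_ring_module: "module R (ring_module R)"
  by (rule module_criteria)
    (auto simp: ring_module_def m_assoc l_distr r_distr intro: is_cring a_comm a_assoc r_neg)

text \<open>On \<open>X\<close>, \<open>\<phi>\<close> is the sum of
  \<open>\<phi> \<circ> f \<circ> g\<close> and \<open>\<phi> \<circ> h\<close>. The second is
  defined on all of \<open>P\<close>, and the first becomes so once \<open>\<phi> \<circ> f\<close>
  is extended from \<open>Y\<close> to \<open>Q\<close>.\<close>

lemma homs_extend_stable_retract:
  assumes P: "module R P" and X: "X \<subseteq> carrier P" and ret: "stable_retract R P X Q Y"
    and ext: "homs_extend R Q Y" and YQ: "Y \<subseteq> carrier Q"
  shows "homs_extend R P X"
  unfolding homs_extend_def
proof
  interpret P: module R P by fact
  fix \<phi> assume \<phi>: "\<phi> \<in> module_hom R (P\<lparr>carrier := X\<rparr>) (ring_module R)"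
  obtain f g h where f: "f \<in> module_hom R (Q\<lparr>carrier := Y\<rparr>) P" "f ` Y \<subseteq> X"
    and g: "g \<in> module_hom R P Q" "g ` X \<subseteq> Y"
    and h: "h \<in> module_hom R P P" "h ` carrier P \<subseteq> X"
    and x: "\<forall>x\<in>X. x = f (g x) \<oplus>\<^bsub>P\<^esub> h x"
    using ret unfolding stable_retract_def by (elim bexE conjE)
  have "(\<lambda>y. \<phi> (f y)) \<in> module_hom R (Q\<lparr>carrier := Y\<rparr>) (ring_module R)"
    using f \<phi> YQ unfolding module_hom_def by (auto simp: Pi_iff image_subset_iff subset_iff)
  then obtain \<psi> where \<psi>: "\<psi> \<in> module_hom R Q (ring_module R)"
    and eq: "\<And>y. y \<in> Y \<Longrightarrow> \<psi> y = \<phi> (f y)"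
    using ext unfolding homs_extend_def by (elim ballE) auto
  have h': "(\<lambda>x. \<phi> (h x)) \<in> module_hom R P (ring_module R)"
    using h \<phi> unfolding module_hom_def by (auto simp: Pi_iff image_subset_iff)
  have *: "(\<lambda>x. \<psi> (g x) \<oplus>\<^bsub>ring_module R\<^esub> \<phi> (h x)) \<in> module_hom R P (ring_module R)"
    by (rule hom_add[OF P P.module_ring_module hom_comp[OF g(1) \<psi>] h'])
  have "\<psi> (g z) \<oplus>\<^bsub>ring_module R\<^esub> \<phi> (h z) = \<phi> z" if z: "z \<in> X" for z
  proof -
    have "f (g z) \<in> X" "h z \<in> X" using z f g h X by blast+
    then have "\<phi> (f (g z) \<oplus>\<^bsub>P\<^esub> h z) = \<phi> (f (g z)) \<oplus>\<^bsub>ring_module R\<^esub> \<phi> (h z)"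
      using module_hom_add[OF \<phi>] by simp
    moreover have "\<psi> (g z) = \<phi> (f (g z))" using eq g z by blast
    ultimately show ?thesis using arg_cong[OF bspec[OF x z], of \<phi>] by simp
  qed
  with * show "\<exists>\<psi>\<in>module_hom R P (ring_module R). \<forall>x\<in>X. \<psi> x = \<phi> x"
    by (intro bexI[of _ "\<lambda>x. \<psi> (g x) \<oplus>\<^bsub>ring_module R\<^esub> \<phi> (h x)"]) auto
qed

text \<open>Follow \<open>f\<close> and \<open>h\<close> by the projection \<open>\<pi>\<close> of
  \<open>X\<close> onto its summand \<open>A\<close>.\<close>

lemma stable_retract_summand:
  assumes ret: "stable_retract R P X Q Y" and XP: "X \<subseteq> carrier P"
    and \<pi>: "\<pi> \<in> module_hom R (P\<lparr>carrier := X\<rparr>) P" "\<pi> ` X \<subseteq> A"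
    and A: "A \<subseteq> X" "\<And>x. x \<in> A \<Longrightarrow> \<pi> x = x"
  shows "stable_retract R P A Q Y"
proof -
  obtain f g h where f: "f \<in> module_hom R (Q\<lparr>carrier := Y\<rparr>) P" "f ` Y \<subseteq> X"
    and g: "g \<in> module_hom R P Q" "g ` X \<subseteq> Y"
    and h: "h \<in> module_hom R P P" "h ` carrier P \<subseteq> X"
    and x: "\<forall>x\<in>X. x = f (g x) \<oplus>\<^bsub>P\<^esub> h x"
    using ret unfolding stable_retract_def by (elim bexE conjE)
  have f': "(\<lambda>y. \<pi> (f y)) \<in> module_hom R (Q\<lparr>carrier := Y\<rparr>) P"
    using f \<pi>(1) unfolding module_hom_def by (auto simp: Pi_iff image_subset_iff)
  have h': "(\<lambda>x. \<pi> (h x)) \<in> module_hom R P P"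
    using h \<pi>(1) unfolding module_hom_def by (auto simp: Pi_iff image_subset_iff)
  show ?thesis
    unfolding stable_retract_def
  proof (intro bexI[OF _ f'] bexI[OF _ g(1)] bexI[OF _ h'] conjI ballI)
    show "(\<lambda>y. \<pi> (f y)) ` Y \<subseteq> A" using f(2) \<pi>(2) by (auto simp: image_subset_iff)
    show "g ` A \<subseteq> Y" using g(2) A(1) by (auto simp: image_subset_iff)
    show "(\<lambda>x. \<pi> (h x)) ` carrier P \<subseteq> A" using h(2) \<pi>(2) by (auto simp: image_subset_iff)
    fix z assume "z \<in> A"
    then have z: "z \<in> X" "\<pi> z = z" using A by auto
    then have "f (g z) \<in> X" "h z \<in> X" using f(2) g(2) h(2) XP by (auto simp: image_subset_iff)
    then have "\<pi> (f (g z) \<oplus>\<^bsub>P\<^esub> h z) = \<pi> (f (g z)) \<oplus>\<^bsub>P\<^esub> \<pi> (h z)"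
      using module_hom_add[OF \<pi>(1)] by simp
    then show "z = \<pi> (f (g z)) \<oplus>\<^bsub>P\<^esub> \<pi> (h z)"
      using arg_cong[OF bspec[OF x z(1)], of \<pi>] z(2) by simp
  qed
qed

text \<open>Both comparison lemmas below end in this computation: \<open>x - f (g x) - k x\<close>
  defines an endomorphism of \<open>P\<close>, \<open>eq\<close> says that \<open>p\<close> kills
  its values, and on the kernel of \<open>p\<close> the correction \<open>k\<close>
  disappears.\<close>

lemma stable_retract_kernelI:
  assumes P: "module R P" and N: "module R N"
    and p: "p \<in> module_hom R P N"
    and f: "f \<in> module_hom R Q P" and g: "g \<in> module_hom R P Q" and k: "k \<in> module_hom R P P"
    and fY: "\<And>y. y \<in> Y \<Longrightarrow> p (f y) = \<zero>\<^bsub>N\<^esub>" and YQ: "Y \<subseteq> carrier Q"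
    and gX: "\<And>x. x \<in> carrier P \<Longrightarrow> p x = \<zero>\<^bsub>N\<^esub> \<Longrightarrow> g x \<in> Y \<and> k x = \<zero>\<^bsub>P\<^esub>"
    and eq: "\<And>x. x \<in> carrier P \<Longrightarrow> p (f (g x)) \<oplus>\<^bsub>N\<^esub> p (k x) = p x"
  shows "stable_retract R P {x \<in> carrier P. p x = \<zero>\<^bsub>N\<^esub>} Q Y"
proof -
  interpret P: module R P by fact
  interpret N: module R N by fact
  interpret p: mod_hom R P N p by unfold_locales (rule p)
  have c: "g x \<in> carrier Q" "f (g x) \<in> carrier P" "k x \<in> carrier P" if "x \<in> carrier P" for x
    using f g k that unfolding module_hom_def by auto
  let ?h = "\<lambda>x. x \<oplus>\<^bsub>P\<^esub> \<ominus>\<^bsub>P\<^esub> (f (g x) \<oplus>\<^bsub>P\<^esub> k x)"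
  have h: "?h \<in> module_hom R P P"
    by (intro hom_add[OF P P] hom_uminus[OF P P] hom_id k hom_comp[OF g f])
  have ph: "p (?h x) = \<zero>\<^bsub>N\<^esub>" if x: "x \<in> carrier P" for x
  proof -
    have "p (?h x) = p x \<oplus>\<^bsub>N\<^esub> \<ominus>\<^bsub>N\<^esub> (p (f (g x)) \<oplus>\<^bsub>N\<^esub> p (k x))"
      using c[OF x] x by (simp del: P.M.minus_add N.M.minus_add)
    then show ?thesis using eq[OF x] x by (simp add: N.M.r_neg)
  qed
  show ?thesis
    unfolding stable_retract_def
  proof (intro bexI[OF _ hom_restrict[OF f YQ]] bexI[OF _ g] bexI[OF _ h] conjI ballI)
    show "f ` Y \<subseteq> {x \<in> carrier P. p x = \<zero>\<^bsub>N\<^esub>}"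
      using f fY YQ unfolding module_hom_def by auto
    show "g ` {x \<in> carrier P. p x = \<zero>\<^bsub>N\<^esub>} \<subseteq> Y" using gX by auto
    show "?h ` carrier P \<subseteq> {x \<in> carrier P. p x = \<zero>\<^bsub>N\<^esub>}"
      using ph h unfolding module_hom_def by auto
    fix x assume "x \<in> {x \<in> carrier P. p x = \<zero>\<^bsub>N\<^esub>}"
    then have x: "x \<in> carrier P" and "k x = \<zero>\<^bsub>P\<^esub>" using gX by auto
    then show "x = f (g x) \<oplus>\<^bsub>P\<^esub> ?h x"
      using c[OF x] by (simp add: P.M.a_ac P.M.r_neg2 P.M.r_neg)
  qed
qed

section \<open>Comparison of covers and of their kernels\<close>

context cring
begin

text \<open>As in Schanuel's lemma, lift each cover through the other. Then
  \<open>p (f (g x)) = p x\<close> already, so the correction \<open>k\<close> is zero.\<close>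

lemma stable_retract_covers:
  assumes one: "\<one> \<noteq> \<zero>" and P: "fg_module R P" "free_module R P"
    and Q: "fg_module R Q" "free_module R Q" and N: "module R N"
    and p: "p \<in> module_hom R P N" "p ` carrier P = carrier N"
    and q: "q \<in> module_hom R Q N" "q ` carrier Q = carrier N"
  shows "stable_retract R P {x \<in> carrier P. p x = \<zero>\<^bsub>N\<^esub>} Q {y \<in> carrier Q. q y = \<zero>\<^bsub>N\<^esub>}"
proof -
  have mP: "module R P" and mQ: "module R Q" using P Q by (simp_all add: fg_module_def)
  interpret P: module R P by fact
  interpret N: module R N by fact
  interpret p: mod_hom R P N p by unfold_locales (rule p)
  have "q ` carrier Q \<subseteq> p ` carrier P" "p ` carrier P \<subseteq> q ` carrier Q" using p q by simp_all
  from free_lift[OF one Q N mP p(1) q(1) this(1)] free_lift[OF one P N mQ q(1) p(1) this(2)]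
  obtain f g where f: "f \<in> module_hom R Q P" "\<forall>y\<in>carrier Q. p (f y) = q y"
    and g: "g \<in> module_hom R P Q" "\<forall>x\<in>carrier P. q (g x) = p x"
    by (elim bexE)
  have k: "(\<lambda>x. \<zero>\<^bsub>P\<^esub>) \<in> module_hom R P P" by (simp add: module_hom_def)
  have gc: "g x \<in> carrier Q" if "x \<in> carrier P" for x using g that unfolding module_hom_def by blast
  show ?thesis
    by (rule stable_retract_kernelI[OF mP N p(1) f(1) g(1) k]) (use f g gc in auto)
qed

text \<open>The three maps of a stable retract lift along the covers \<open>p\<close> and
  \<open>q\<close> of the two submodules, and the lifts compare the kernels.\<close>

lemma stable_retract_syzygies:
  assumes one: "\<one> \<noteq> \<zero>" and P': "fg_module R P'" "free_module R P'"
    and Q': "fg_module R Q'" "free_module R Q'" and P: "fg_module R P" "free_module R P" and Q: "module R Q"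
    and p: "p \<in> module_hom R P' P" and q: "q \<in> module_hom R Q' Q"
    and ret: "stable_retract R P (p ` carrier P') Q (q ` carrier Q')"
  shows "stable_retract R P' {x \<in> carrier P'. p x = \<zero>\<^bsub>P\<^esub>} Q' {y \<in> carrier Q'. q y = \<zero>\<^bsub>Q\<^esub>}"
proof -
  have mP': "module R P'" and mQ': "module R Q'" and mP: "module R P"
    using P' Q' P by (simp_all add: fg_module_def)
  interpret P': module R P' by fact
  interpret Q': module R Q' by fact
  interpret P: module R P by fact
  interpret Q: module R Q by fact
  obtain f g h where f: "f \<in> module_hom R (Q\<lparr>carrier := q ` carrier Q'\<rparr>) P" "f ` (q ` carrier Q') \<subseteq> p ` carrier P'"
    and g: "g \<in> module_hom R P Q" "g ` (p ` carrier P') \<subseteq> q ` carrier Q'"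
    and h: "h \<in> module_hom R P P" "h ` carrier P \<subseteq> p ` carrier P'"
    and eq: "\<forall>x\<in>p ` carrier P'. x = f (g x) \<oplus>\<^bsub>P\<^esub> h x"
    using ret unfolding stable_retract_def by (elim bexE conjE)
  interpret p: mod_hom R P' P p by unfold_locales (rule p)
  have "module R (Q\<lparr>carrier := q ` carrier Q'\<rparr>)"
    by (rule Q.submodule_is_module) (rule submodule_hom_image[OF mQ' Q q])
  then interpret f: mod_hom R "Q\<lparr>carrier := q ` carrier Q'\<rparr>" P f
    using f(1) mP by (simp add: mod_hom_def mod_hom_axioms_def)
  have f_zero: "f \<zero>\<^bsub>Q\<^esub> = \<zero>\<^bsub>P\<^esub>" using f.f0_is_0 by simp
  interpret g: mod_hom R P Q g by unfold_locales (rule g)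
  interpret h: mod_hom R P P h by unfold_locales (rule h)
  have "(\<lambda>y. f (q y)) ` carrier Q' \<subseteq> p ` carrier P'" using f(2) by (simp add: image_image)
  from free_lift[OF one Q' mP mP' p hom_comp[OF hom_corestrict[OF q] f(1)] this]
  obtain f' where f': "f' \<in> module_hom R Q' P'" "\<forall>y\<in>carrier Q'. p (f' y) = f (q y)"
    by (elim bexE)
  have "(\<lambda>x. g (p x)) ` carrier P' \<subseteq> q ` carrier Q'" using g(2) by (simp add: image_image)
  from free_lift[OF one P' Q mQ' q hom_comp[OF p g(1)] this]
  obtain g' where g': "g' \<in> module_hom R P' Q'" "\<forall>x\<in>carrier P'. q (g' x) = g (p x)"
    by (elim bexE)
  interpret g': mod_hom R P' Q' g' by unfold_locales (rule g')
  \<comment> \<open>\<open>h\<close> maps all of \<open>P\<close> into the image of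
    \<open>p\<close>, so it lifts to \<open>v\<close>. The correction is \<open>v\<close> after
    \<open>p\<close>: it vanishes on the kernel of \<open>p\<close>, and \<open>p\<close> takes it
    to \<open>h (p x)\<close>, the part of \<open>p x\<close> not given by
    \<open>f (g (p x))\<close>.\<close>
  from free_lift[OF one P mP mP' p h]
  obtain v where v: "v \<in> module_hom R P P'" "\<forall>x\<in>carrier P. p (v x) = h x"
    by (elim bexE)
  interpret v: mod_hom R P P' v by unfold_locales (rule v)
  have pc: "p x \<in> carrier P" if "x \<in> carrier P'" for x using that by simp
  show ?thesis
  proof (rule stable_retract_kernelI[OF mP' mP p f'(1) g'(1) hom_comp[OF p v(1)]])
    fix x assume x: "x \<in> carrier P'"
    show "p (f' (g' x)) \<oplus>\<^bsub>P\<^esub> p (v (p x)) = p x"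
      using f'(2) g'(2) v(2) x bspec[OF eq imageI[OF x], symmetric] by simp
    show "g' x \<in> {y \<in> carrier Q'. q y = \<zero>\<^bsub>Q\<^esub>} \<and> v (p x) = \<zero>\<^bsub>P'\<^esub>" if "p x = \<zero>\<^bsub>P\<^esub>"
      using that g'(2) x by simp
  qed (use f'(2) f_zero in auto)
qed

end


section \<open>Vanishing of Ext\<close>

text \<open>A homomorphism \<open>\<phi>\<close> on the image of \<open>d i\<close> gives the
  cocycle \<open>\<phi> \<circ> d i\<close> of degree \<open>Suc i\<close>, because consecutive
  differentials compose to zero. Writing it as a coboundary \<open>\<psi> \<circ> d i\<close> yields
  the extension \<open>\<psi>\<close>.\<close>

lemma Ext_zero_homs_extend:
  fixes R (structure)
  assumes R: "cring R" and res: "fg_free_resolution R M F d e"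
    and zero: "zero_module (hom_cohomology R F d (ring_module R) (Suc i))"
  shows "homs_extend R (F i) (d i ` carrier (F (Suc i)))"
  unfolding homs_extend_def
proof
  interpret cring R by fact
  let ?S = "ring_module R" and ?X = "d i ` carrier (F (Suc i))"
  let ?H = "hom_module R (F (Suc i)) ?S"
  let ?C = "?H\<lparr>carrier := cocycles R F d ?S (Suc i)\<rparr>"
  have F: "module R (F k)" for k using res by (simp add: fg_free_resolution_def fg_module_def)
  have d: "d k \<in> module_hom R (F (Suc k)) (F k)" for k using res by (simp add: fg_free_resolution_def)
  interpret S: module R ?S by (rule module_ring_module)
  have zero_in: "\<zero>\<^bsub>?H\<^esub> \<in> coboundaries R F d ?S (Suc i)"
  proof -
    have "\<zero>\<^bsub>hom_module R (F i) ?S\<^esub> \<in> carrier (hom_module R (F i) ?S)"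
    proof -
      interpret Fi: module R "F i" by (rule F)
      show ?thesis by (simp add: hom_module_def module_hom_def)
    qed
    moreover have "hom_differential F d i \<zero>\<^bsub>hom_module R (F i) ?S\<^esub> = \<zero>\<^bsub>?H\<^esub>"
      using d[of i] by (auto simp: hom_differential_def hom_module_def compose_def module_hom_def intro!: restrict_ext)
    ultimately show ?thesis by (metis coboundaries.simps(2) imageI)
  qed
  \<comment> \<open>The only coset is \<open>?B\<close> itself. The coset of \<open>f\<close>
    contains \<open>0 + f\<close>, as \<open>?B\<close> contains zero, and \<open>0 + f\<close>
    equals \<open>f\<close> because \<open>f\<close> is extensional.\<close>
  have cob: "f \<in> coboundaries R F d ?S (Suc i)" if f: "f \<in> cocycles R F d ?S (Suc i)" for f
  proof -
    let ?B = "coboundaries R F d ?S (Suc i)"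
    have "?B +>\<^bsub>?C\<^esub> f \<in> a_rcosets\<^bsub>?C\<^esub> ?B"
      using f by (auto simp: A_RCOSETS_def RCOSETS_def a_r_coset_def)
    then have "?B +>\<^bsub>?C\<^esub> f = ?B"
      using zero by (simp add: zero_module_def hom_cohomology_def quotient_module_def)
    moreover have "\<zero>\<^bsub>?H\<^esub> \<oplus>\<^bsub>?H\<^esub> f \<in> ?B +>\<^bsub>?C\<^esub> f"
      using zero_in by (auto simp: a_r_coset_def r_coset_def simp del: coboundaries.simps)
    moreover have "\<zero>\<^bsub>?H\<^esub> \<oplus>\<^bsub>?H\<^esub> f = f"
    proof
      fix v
      have "f \<in> extensional (carrier (F (Suc i)))" "f \<in> carrier (F (Suc i)) \<rightarrow> carrier ?S"
        using f by (auto simp: cocycles_def hom_module_def module_hom_def)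
      then show "(\<zero>\<^bsub>?H\<^esub> \<oplus>\<^bsub>?H\<^esub> f) v = f v"
        by (auto simp: hom_module_def restrict_def extensional_def dest: Pi_mem intro!: S.M.l_zero)
    qed
    ultimately show ?thesis by simp
  qed
  fix \<phi> assume \<phi>: "\<phi> \<in> module_hom R ((F i)\<lparr>carrier := ?X\<rparr>) ?S"
  let ?f = "\<lambda>v\<in>carrier (F (Suc i)). \<phi> (d i v)"
  interpret F1: module R "F (Suc i)" by (rule F)
  interpret Fi: module R "F i" by (rule F)
  have "module R ((F i)\<lparr>carrier := ?X\<rparr>)"
    by (rule Fi.submodule_is_module) (rule submodule_hom_image[OF F F d])
  then interpret \<phi>: mod_hom R "(F i)\<lparr>carrier := ?X\<rparr>" ?S \<phi>
    using \<phi> by (simp add: mod_hom_def mod_hom_axioms_def S.module_axioms)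
  have f_hom: "?f \<in> module_hom R (F (Suc i)) ?S"
    using d[of i] \<phi> unfolding module_hom_def by (auto simp: Pi_iff)
  have dd: "d i (d (Suc i) v) = \<zero>\<^bsub>F i\<^esub>" "d (Suc i) v \<in> carrier (F (Suc i))"
    if "v \<in> carrier (F (Suc (Suc i)))" for v
    using res that unfolding fg_free_resolution_def by blast+
  have "hom_differential F d (Suc i) ?f = \<zero>\<^bsub>hom_module R (F (Suc (Suc i))) ?S\<^esub>"
    using dd \<phi>.f0_is_0 by (auto simp: hom_differential_def hom_module_def compose_def intro!: restrict_ext)
  then have "?f \<in> cocycles R F d ?S (Suc i)"
    using f_hom by (simp add: cocycles_def hom_module_def)
  from cob[OF this] obtain \<psi> where \<psi>: "\<psi> \<in> module_hom R (F i) ?S"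
    and eq: "?f = hom_differential F d i \<psi>"
    by (auto simp: hom_module_def)
  have "\<psi> (d i v) = \<phi> (d i v)" if "v \<in> carrier (F (Suc i))" for v
    using fun_cong[OF eq, of v] that by (simp add: hom_differential_def compose_def)
  then show "\<exists>\<psi>\<in>module_hom R (F i) ?S. \<forall>x\<in>?X. \<psi> x = \<phi> x" using \<psi> by blast
qed

section \<open>Local rings with decomposable maximal ideal\<close>

locale decomposable_local_ring = cring R for R (structure) +
  fixes m I J
  assumes noetherian: "noetherian_ring R" and artinian: "artinian_ring R" and local: "local_ring R m"
    and ideal_I: "ideal I R" and ideal_J: "ideal J R"
    and I_nonzero: "I \<noteq> {\<zero>}" and J_nonzero: "J \<noteq> {\<zero>}"
    and I_Int_J: "I \<inter> J = {\<zero>}" and m_eq: "m = I <+>\<^bsub>R\<^esub> J"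
begin

text \<open>The hypotheses are symmetric in \<open>I\<close> and \<open>J\<close>, while
  \<open>not_stable_retract\<close> is proved for coordinates in \<open>J\<close>; this gives the
  other case.\<close>

lemma swap: "decomposable_local_ring R m J I"
proof (rule decomposable_local_ring.intro[OF is_cring], rule decomposable_local_ring_axioms.intro)
  interpret I: ideal I R by (rule ideal_I)
  interpret J: ideal J R by (rule ideal_J)
  show "m = J <+>\<^bsub>R\<^esub> I"
    using m_eq set_add_comm[OF I.a_subset J.a_subset] by (rule trans)
  show "J \<inter> I = {\<zero>}" using I_Int_J by (simp add: Int_commute)
qed (rule noetherian artinian local ideal_I ideal_J I_nonzero J_nonzero)+

section \<open>Annihilators and the maximal ideal\<close>

lemma maximalideal_m: "maximalideal m R"
  using local unfolding local_ring_def by (elim conjE)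

sublocale m: ideal m R
  using maximalideal_m by (rule maximalideal.axioms(1))

sublocale I: ideal I R by (rule ideal_I)

sublocale J: ideal J R by (rule ideal_J)

lemma one_notin_m: "\<one> \<notin> m"
proof
  assume "\<one> \<in> m"
  then have "carrier R = m" by (rule m.one_imp_carrier[symmetric])
  then show False by (rule notE[OF maximalideal.I_notcarr[OF maximalideal_m]])
qed

lemma one_not_zero: "\<one> \<noteq> \<zero>"
proof
  assume "\<one> = \<zero>"
  then have "\<one> \<in> m" using m.zero_closed by simp
  then show False using one_notin_m by simp
qed

text \<open>An element outside \<open>m\<close> is a unit and kills nothing but zero.\<close>

lemma annihilator_subset_m:
  assumes "s \<in> carrier R" "x \<in> carrier R" "x \<noteq> \<zero>" "s \<otimes> x = \<zero>"
  shows "s \<in> m"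
proof (rule ccontr)
  assume "s \<notin> m"
  then have u: "s \<in> Units R" by (rule local_ring_Units[OF noetherian local assms(1)])
  have "x = (inv s \<otimes> s) \<otimes> x" using u assms by (simp add: Units_l_inv)
  also have "\<dots> = inv s \<otimes> (s \<otimes> x)" using u assms by (intro m_assoc) auto
  finally show False using assms u by simp
qed

text \<open>Nakayama's lemma for one element: for nonzero \<open>x\<close>, the equation
  \<open>(1 - t) x = 0\<close> would put \<open>1 - t\<close>, and with it 1, into
  \<open>m\<close>.\<close>

lemma fixed_by_m_zero:
  assumes t: "t \<in> m" and x: "x \<in> carrier R" and eq: "t \<otimes> x = x"
  shows "x = \<zero>"
proof (rule ccontr)
  assume nz: "x \<noteq> \<zero>"
  have tR: "t \<in> carrier R" using t m.Icarr by blast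
  have "(\<one> \<ominus> t) \<otimes> x = \<zero>" using tR x eq by (simp add: minus_eq l_distr l_minus r_neg)
  then have "\<one> \<ominus> t \<in> m" using tR x nz by (intro annihilator_subset_m[of _ x]) auto
  then have "(\<one> \<ominus> t) \<oplus> t \<in> m" using t by (intro m.a_closed)
  moreover have "(\<one> \<ominus> t) \<oplus> t = \<one>" using tR by (simp add: minus_eq a_assoc l_neg)
  ultimately show False using one_notin_m by simp
qed

lemma J_subset_m: "x \<in> J \<Longrightarrow> x \<in> m"
proof -
  assume x: "x \<in> J"
  then have "x = \<zero> \<oplus> x" using J.Icarr by simp
  then show "x \<in> m" unfolding m_eq set_add_def' using x I.zero_closed by blast
qed

lemma mult_I_J: "x \<in> I \<Longrightarrow> y \<in> J \<Longrightarrow> x \<otimes> y = \<zero>"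
proof -
  assume x: "x \<in> I" and y: "y \<in> J"
  have "x \<otimes> y \<in> I \<inter> J"
    using I.I_r_closed[OF x J.Icarr[OF y]] J.I_l_closed[OF y I.Icarr[OF x]] by simp
  then show "x \<otimes> y = \<zero>" by (simp add: I_Int_J)
qed

section \<open>The projection of \<open>m\<close> onto \<open>I\<close> along
  \<open>J\<close>\<close>

lemma sum_I_J_unique:
  assumes "i \<in> I" "j \<in> J" "i' \<in> I" "j' \<in> J" "i \<oplus> j = i' \<oplus> j'"
  shows "i = i'" "j = j'"
proof -
  have c: "i \<in> carrier R" "j \<in> carrier R" "i' \<in> carrier R" "j' \<in> carrier R"
    using assms I.Icarr J.Icarr by auto
  have "i \<ominus> i' = (i \<oplus> j) \<ominus> (i' \<oplus> j)" using c by algebra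
  also have "\<dots> = (i' \<oplus> j') \<ominus> (i' \<oplus> j)" using assms(5) by simp
  also have "\<dots> = j' \<ominus> j" using c by algebra
  finally have eq: "i \<ominus> i' = j' \<ominus> j" .
  have "i \<ominus> i' \<in> I" "j' \<ominus> j \<in> J"
    using assms by (auto simp: minus_eq)
  then have 0: "i \<ominus> i' = \<zero>" using eq I_Int_J by auto
  have "i = (i \<ominus> i') \<oplus> i'" using c by algebra
  then show "i = i'" using 0 c by simp
  have "j' = (j' \<ominus> j) \<oplus> j" using c by algebra
  then show "j = j'" using 0 eq c by simp
qed

text \<open>A total function, unspecified outside \<open>m\<close>; on \<open>m\<close> the
  decomposition exists and is unique.\<close>

definition projI :: "'a \<Rightarrow> 'a"
  where "projI t = (THE i. i \<in> I \<and> (\<exists>j\<in>J. t = i \<oplus> j))"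

lemma projI_eq:
  assumes "i \<in> I" "j \<in> J"
  shows "projI (i \<oplus> j) = i"
  unfolding projI_def
proof (rule the_equality)
  show "i \<in> I \<and> (\<exists>j'\<in>J. i \<oplus> j = i \<oplus> j')" using assms by auto
  show "i' = i" if "i' \<in> I \<and> (\<exists>j'\<in>J. i \<oplus> j = i' \<oplus> j')" for i'
    using that sum_I_J_unique(1)[OF assms] by metis
qed

lemma mE:
  assumes "t \<in> m"
  obtains i j where "i \<in> I" "j \<in> J" "t = i \<oplus> j"
proof -
  have "\<exists>i\<in>I. \<exists>j\<in>J. t = i \<oplus> j"
    using assms by (simp add: m_eq set_add_def')
  then show ?thesis by (elim bexE) (rule that)
qed

lemma projI_in: "t \<in> m \<Longrightarrow> projI t \<in> I"
proof (erule mE)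
  show "projI t \<in> I" if "i \<in> I" "j \<in> J" "t = i \<oplus> j" for i j
    unfolding that(3) projI_eq[OF that(1,2)] by (rule that(1))
qed

lemma minus_projI_in: "t \<in> m \<Longrightarrow> t \<ominus> projI t \<in> J"
proof (erule mE)
  fix i j assume ij: "i \<in> I" "j \<in> J" "t = i \<oplus> j"
  then have c: "i \<in> carrier R" "j \<in> carrier R" using I.Icarr J.Icarr by auto
  have "(i \<oplus> j) \<ominus> i = j" using c by algebra
  then show "t \<ominus> projI t \<in> J" using ij by (simp add: projI_eq)
qed

lemma projI_I: "t \<in> I \<Longrightarrow> projI t = t"
proof -
  assume t: "t \<in> I"
  then show "projI t = t" using projI_eq[OF t J.zero_closed] by simp
qed

lemma projI_J: "t \<in> J \<Longrightarrow> projI t = \<zero>"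
proof -
  assume t: "t \<in> J"
  then show "projI t = \<zero>" using projI_eq[OF I.zero_closed t] by simp
qed

lemma projI_add:
  assumes "s \<in> m" "t \<in> m"
  shows "projI (s \<oplus> t) = projI s \<oplus> projI t"
proof -
  obtain i j where s: "i \<in> I" "j \<in> J" "s = i \<oplus> j" using assms(1) by (rule mE)
  obtain i' j' where t: "i' \<in> I" "j' \<in> J" "t = i' \<oplus> j'" using assms(2) by (rule mE)
  have c: "i \<in> carrier R" "j \<in> carrier R" "i' \<in> carrier R" "j' \<in> carrier R"
    using s t I.Icarr J.Icarr by auto
  have "s \<oplus> t = (i \<oplus> i') \<oplus> (j \<oplus> j')" unfolding s t using c by algebra
  then have "projI (s \<oplus> t) = i \<oplus> i'" using s t by (simp add: projI_eq)
  then show ?thesis using s t by (simp add: projI_eq)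
qed

lemma projI_mult:
  assumes "r \<in> carrier R" "t \<in> m"
  shows "projI (r \<otimes> t) = r \<otimes> projI t"
proof -
  obtain i j where t: "i \<in> I" "j \<in> J" "t = i \<oplus> j" using assms(2) by (rule mE)
  have c: "i \<in> carrier R" "j \<in> carrier R" using t I.Icarr J.Icarr by auto
  have "r \<otimes> t = (r \<otimes> i) \<oplus> (r \<otimes> j)" unfolding t using c assms(1) by algebra
  then have "projI (r \<otimes> t) = r \<otimes> i"
    using t assms(1) I.I_l_closed J.I_l_closed by (simp add: projI_eq)
  then show ?thesis using t by (simp add: projI_eq)
qed

text \<open>Otherwise one could keep multiplying a nonzero element of \<open>K\<close> by elements
  of \<open>m\<close> without reaching zero. The descending principal ideals become stationary, so
  some nonzero \<open>z n\<close> is a multiple of itself by an element of \<open>m\<close>, against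
  \<open>fixed_by_m_zero\<close>.\<close>

lemma socle_element:
  assumes K: "ideal K R" "K \<noteq> {\<zero>}"
  shows "\<exists>x\<in>K. x \<noteq> \<zero> \<and> (\<forall>t\<in>m. t \<otimes> x = \<zero>)"
proof (rule ccontr)
  interpret K: ideal K R by fact
  assume "\<not> ?thesis"
  then have "\<forall>x. \<exists>t. x \<in> K \<and> x \<noteq> \<zero> \<longrightarrow> t \<in> m \<and> t \<otimes> x \<noteq> \<zero>" by blast
  then obtain \<tau> where \<tau>: "\<And>x. x \<in> K \<Longrightarrow> x \<noteq> \<zero> \<Longrightarrow> \<tau> x \<in> m \<and> \<tau> x \<otimes> x \<noteq> \<zero>" by metis
  obtain x0 where x0: "x0 \<in> K" "x0 \<noteq> \<zero>" using K(2) K.zero_closed by blast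
  define z where "z = rec_nat x0 (\<lambda>_ x. \<tau> x \<otimes> x)"
  have z_0: "z 0 = x0" and z_Suc: "z (Suc k) = \<tau> (z k) \<otimes> z k" for k by (simp_all add: z_def)
  have z: "z k \<in> K \<and> z k \<noteq> \<zero>" for k
  proof (induction k)
    case (Suc k)
    then show ?case using \<tau>[of "z k"] m.Icarr K.I_l_closed by (simp add: z_Suc)
  qed (use x0 in \<open>simp add: z_0\<close>)
  then have zR: "z k \<in> carrier R" and \<tau>R: "\<tau> (z k) \<in> carrier R" for k
    using K.Icarr \<tau> m.Icarr by blast+
  have "PIdl (z (Suc k)) \<subseteq> PIdl (z k)" for k
    using zR \<tau>R by (intro cgenideal_minimal cgenideal_ideal) (auto simp: z_Suc cgenideal_def)
  moreover have "ideal (PIdl (z k)) R" for k using zR by (rule cgenideal_ideal)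
  ultimately obtain n where "\<forall>i\<ge>n. PIdl (z i) = PIdl (z n)"
    using artinian unfolding artinian_ring_def by (elim conjE allE[of _ "\<lambda>k. PIdl (z k)"]) auto
  then have "PIdl (z n) = PIdl (z (Suc n))" by (metis le_SucI order_refl)
  then have "z n \<in> PIdl (z (Suc n))" using cgenideal_self[OF zR[of n]] by simp
  then obtain r where r: "r \<in> carrier R" "z n = r \<otimes> (\<tau> (z n) \<otimes> z n)"
    by (auto simp: cgenideal_def z_Suc)
  then have "(r \<otimes> \<tau> (z n)) \<otimes> z n = z n" using zR \<tau>R by (simp add: m_assoc)
  moreover have "r \<otimes> \<tau> (z n) \<in> m" using r \<tau> z by (intro m.I_l_closed) auto
  ultimately have "z n = \<zero>" using fixed_by_m_zero zR by blast
  then show False using z by blast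
qed

section \<open>A homomorphism that does not extend\<close>

lemma hom_fr_coordinates:
  assumes K: "ideal K R" and p: "p \<in> module_hom R (fr R b) (fr R a)"
    and v: "v \<in> carrier (fr R b)" "\<And>k. v k \<in> K"
  shows "p v i \<in> K"
proof -
  interpret K: ideal K R by fact
  let ?y = "\<lambda>i. p (unitv R i)"
  have y: "?y k \<in> carrier (fr R a)" if "k < b" for k by (rule hom_fr_comp_unitv[OF module_fr p that])
  have "k \<le> b \<Longrightarrow> lin (fr R a) ?y k v i \<in> K" for k
  proof (induction k)
    case 0
    interpret F: module R "fr R a" by (rule module_fr)
    show ?case by (simp add: lin_def)
  next
    case (Suc k)
    have "lin (fr R a) ?y (Suc k) v = v k \<odot>\<^bsub>fr R a\<^esub> ?y k \<oplus>\<^bsub>fr R a\<^esub> lin (fr R a) ?y k v"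
      using Suc.prems y v by (intro lin_Suc[OF module_fr]) (auto simp: fr_carrier)
    then have "lin (fr R a) ?y (Suc k) v i = v k \<otimes> ?y k i \<oplus> lin (fr R a) ?y k v i" by simp
    moreover have "?y k i \<in> carrier R" using y[of k] Suc.prems by (simp add: fr_carrier)
    ultimately show ?case using Suc v K.I_r_closed by simp
  qed
  then show ?thesis using hom_fr_eq_lin[OF module_fr p v(1)] by simp
qed

text \<open>\<open>ker\<close> expresses minimality of the cover and keeps the coordinates of kernel
  vectors in \<open>m\<close>, where \<open>projI\<close> is linear. \<open>im\<close> puts
  \<open>x ?u\<close> and \<open>y ?u\<close> into the kernel. An extension \<open>\<psi>\<close> is
  then overdetermined at \<open>?u\<close>: \<open>y\<close> forces it to be 1 modulo
  \<open>m\<close>, while \<open>x\<close> forces \<open>x \<psi>(?u) = 0\<close>.\<close>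

lemma not_homs_extend:
  assumes p: "p \<in> module_hom R (fr R b) (fr R a)"
    and nz: "v \<in> carrier (fr R b)" "p v \<noteq> (\<lambda>i. \<zero>)"
    and im: "\<And>v i. v \<in> carrier (fr R b) \<Longrightarrow> p v i \<in> J"
    and ker: "\<And>v i. v \<in> carrier (fr R b) \<Longrightarrow> p v = (\<lambda>i. \<zero>) \<Longrightarrow> v i \<in> m"
  shows "\<not> homs_extend R (fr R b) {v \<in> carrier (fr R b). p v = \<zero>\<^bsub>fr R a\<^esub>}"
proof
  let ?K = "{v \<in> carrier (fr R b). p v = \<zero>\<^bsub>fr R a\<^esub>}" and ?S = "ring_module R"
  let ?u = "unitv R 0"
  assume ext: "homs_extend R (fr R b) ?K"
  interpret B: module R "fr R b" by (rule module_fr)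
  interpret A: module R "fr R a" by (rule module_fr)
  interpret p: mod_hom R "fr R b" "fr R a" p by unfold_locales (rule p)
  \<comment> \<open>Needed for the first unit vector to lie in \<open>R^b\<close>;
    \<open>R^0\<close> has no vector with nonzero image.\<close>
  have "b \<noteq> 0"
  proof
    assume "b = 0"
    then have "v = \<zero>\<^bsub>fr R b\<^esub>" using nz(1) by (auto simp: fr_carrier intro!: ext)
    then show False using nz(2) p.f0_is_0 by simp
  qed
  then have u: "?u \<in> carrier (fr R b)" by (intro unitv_closed) simp
  have in_K: "r \<odot>\<^bsub>fr R b\<^esub> ?u \<in> ?K" if r: "r \<in> carrier R" "\<And>i. r \<otimes> p ?u i = \<zero>" for r
    using p.f_smult[OF r(1) u] r(2) B.smult_closed[OF r(1) u] by (simp del: fr_simps(3)) simp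
  obtain x where x: "x \<in> J" "x \<noteq> \<zero>" "\<And>t. t \<in> m \<Longrightarrow> t \<otimes> x = \<zero>"
    using socle_element[OF ideal_J J_nonzero] by blast
  obtain y where y: "y \<in> I" "y \<noteq> \<zero>" using I_nonzero I.zero_closed by blast
  have xR: "x \<in> carrier R" and yR: "y \<in> carrier R" using x y I.Icarr J.Icarr by auto
  have pu: "p ?u i \<in> J" "p ?u i \<in> carrier R" for i using im[OF u] J.Icarr by blast+
  \<comment> \<open>\<open>x\<close> kills the coordinates of \<open>p ?u\<close> because they lie
    in \<open>J\<close>, hence in \<open>m\<close>; \<open>y\<close> kills them because
    \<open>I J = 0\<close>.\<close>
  have xK: "x \<odot>\<^bsub>fr R b\<^esub> ?u \<in> ?K"
    by (rule in_K[OF xR]) (use x pu J_subset_m xR m_comm in metis)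
  have yK: "y \<odot>\<^bsub>fr R b\<^esub> ?u \<in> ?K"
    by (rule in_K[OF yR]) (use mult_I_J[OF y(1) pu(1)] in simp)
  have zm: "z i \<in> m" if "z \<in> ?K" for z i using ker that by simp
  have \<phi>: "(\<lambda>z. projI (z 0)) \<in> module_hom R ((fr R b)\<lparr>carrier := ?K\<rparr>) ?S"
    unfolding module_hom_def
  proof (intro CollectI conjI allI impI funcsetI)
    show "projI (z 0) \<in> carrier ?S" if "z \<in> carrier ((fr R b)\<lparr>carrier := ?K\<rparr>)" for z
      using projI_in[OF zm[of z 0]] that I.Icarr by (simp add: ring_module_def)
    show "projI ((z \<oplus>\<^bsub>(fr R b)\<lparr>carrier := ?K\<rparr>\<^esub> z') 0) = projI (z 0) \<oplus>\<^bsub>?S\<^esub> projI (z' 0)"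
      if "z \<in> carrier ((fr R b)\<lparr>carrier := ?K\<rparr>) \<and> z' \<in> carrier ((fr R b)\<lparr>carrier := ?K\<rparr>)" for z z'
      using projI_add[OF zm[of z 0] zm[of z' 0]] that by (simp add: ring_module_def)
    show "projI ((r \<odot>\<^bsub>(fr R b)\<lparr>carrier := ?K\<rparr>\<^esub> z) 0) = r \<odot>\<^bsub>?S\<^esub> projI (z 0)"
      if "r \<in> carrier R \<and> z \<in> carrier ((fr R b)\<lparr>carrier := ?K\<rparr>)" for r z
      using projI_mult[of r, OF _ zm[of z 0]] that by (simp add: ring_module_def)
  qed
  from bspec[OF ext[unfolded homs_extend_def] \<phi>] obtain \<psi> where \<psi>: "\<psi> \<in> module_hom R (fr R b) ?S"
    and eq: "\<forall>z\<in>?K. \<psi> z = projI (z 0)"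
    by (elim bexE)
  have sR: "\<psi> ?u \<in> carrier R" using \<psi> u unfolding module_hom_def by (auto simp: ring_module_def)
  have smult: "r \<otimes> \<psi> ?u = projI r" if "r \<in> carrier R" "r \<odot>\<^bsub>fr R b\<^esub> ?u \<in> ?K" for r
    using bspec[OF eq that(2)] module_hom_smult[OF \<psi> that(1) u] that(1)
    by (simp add: ring_module_def unitv_def)
  have "y \<otimes> \<psi> ?u = y" using smult[OF yR yK] projI_I[OF y(1)] by simp
  moreover have "(\<psi> ?u \<ominus> \<one>) \<otimes> y = y \<otimes> \<psi> ?u \<ominus> y" using yR sR by algebra
  ultimately have "(\<psi> ?u \<ominus> \<one>) \<otimes> y = \<zero>" using yR by (simp add: minus_eq r_neg)
  \<comment> \<open>It annihilates the nonzero \<open>y\<close>, so it lies in \<open>m\<close>;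
    therefore it also annihilates the socle element \<open>x\<close>.\<close>
  then have "\<psi> ?u \<ominus> \<one> \<in> m" using sR yR y(2) by (intro annihilator_subset_m) auto
  then have "(\<psi> ?u \<ominus> \<one>) \<otimes> x = \<zero>" by (rule x(3))
  moreover have "x \<otimes> \<psi> ?u = \<zero>" using smult[OF xR xK] projI_J[OF x(1)] by simp
  moreover have "x = x \<otimes> \<psi> ?u \<ominus> (\<psi> ?u \<ominus> \<one>) \<otimes> x" using xR sR by algebra
  ultimately have "x = \<zero>" by simp
  then show False using x(2) by simp
qed

text \<open>Pass to the kernel of a minimal cover of \<open>A\<close>. It is a stable retract of the
  next syzygy, which moves the index to \<open>Suc i\<close>; \<open>ext\<close> would make
  homomorphisms extend from it, against \<open>not_homs_extend\<close>.\<close>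

lemma not_stable_retract:
  assumes res: "fg_free_resolution R M F d e"
    and A: "LinearCombinations.submodule R A (fr R b)" "A \<noteq> {\<lambda>i. \<zero>}"
    and AJ: "\<forall>z\<in>A. \<forall>i. z i \<in> J"
    and ext: "homs_extend R (F (Suc i)) (d (Suc i) ` carrier (F (Suc (Suc i))))"
  shows "\<not> stable_retract R (fr R b) A (F i) (d i ` carrier (F (Suc i)))"
proof
  assume ret: "stable_retract R (fr R b) A (F i) (d i ` carrier (F (Suc i)))"
  have F: "fg_module R (F k)" "free_module R (F k)" for k using res by (simp_all add: fg_free_resolution_def)
  have F_mod: "module R (F k)" for k using F(1) by (simp add: fg_module_def)
  have d: "d k \<in> module_hom R (F (Suc k)) (F k)" for k using res by (simp add: fg_free_resolution_def)
  have exact: "d (Suc i) ` carrier (F (Suc (Suc i))) = {x \<in> carrier (F (Suc i)). d i x = \<zero>\<^bsub>F i\<^esub>}"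
    using res by (simp add: fg_free_resolution_def)
  obtain S where S: "finite S" "generates R (fr R b) S A"
    using submodule_fr_finitely_generated[OF noetherian is_cring A(1)] by blast
  from minimal_cover[OF noetherian local module_fr A(1) S]
  obtain c q where q: "q \<in> module_hom R (fr R c) (fr R b)" "q ` carrier (fr R c) = A"
    and ker: "\<forall>z\<in>carrier (fr R c). q z = \<zero>\<^bsub>fr R b\<^esub> \<longrightarrow> (\<forall>i. z i \<in> m)"
    by (elim exE bexE conjE)
  have "stable_retract R (fr R c) {z \<in> carrier (fr R c). q z = \<zero>\<^bsub>fr R b\<^esub>}
      (F (Suc i)) {x \<in> carrier (F (Suc i)). d i x = \<zero>\<^bsub>F i\<^esub>}"
    by (rule stable_retract_syzygies[OF one_not_zero fr_fg_free[OF one_not_zero] F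
          fr_fg_free[OF one_not_zero] F_mod q(1) d]) (use ret q(2) in simp)
  then have "homs_extend R (fr R c) {z \<in> carrier (fr R c). q z = \<zero>\<^bsub>fr R b\<^esub>}"
    by (rule homs_extend_stable_retract[OF module_fr, rotated]) (use ext exact in auto)
  moreover have "\<zero>\<^bsub>fr R b\<^esub> \<in> A" using A(1) by (rule LinearCombinations.submodule.zero_closed)
  then obtain a where "a \<in> A" "a \<noteq> (\<lambda>i. \<zero>)" using A(2) by auto
  then obtain v where v: "v \<in> carrier (fr R c)" "q v \<noteq> (\<lambda>i. \<zero>)" using q(2) by blast
  have "\<not> homs_extend R (fr R c) {z \<in> carrier (fr R c). q z = \<zero>\<^bsub>fr R b\<^esub>}"
    by (rule not_homs_extend[OF q(1) v]) (use q(2) AJ ker in auto)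
  ultimately show False by simp
qed

text \<open>
  Why the new syzygy splits: for \<open>z\<close> in it, the
  \<open>I\<close>- and \<open>J\<close>-parts are mapped into \<open>I\<close>- and \<open>J\<close>-coordinates respectively and the images add up
  to zero, hence each part is again in the syzygy.
\<close>

lemma minimal_syzygy:
  assumes res: "fg_free_resolution R M F d e"
    and T: "LinearCombinations.submodule R T (fr R a)" "T \<noteq> {\<lambda>i. \<zero>}"
    and Tm: "\<forall>z\<in>T. \<forall>i. z i \<in> m"
    and ret: "stable_retract R (fr R a) T (F i) (d i ` carrier (F (Suc i)))"
  shows "\<exists>b T'. LinearCombinations.submodule R T' (fr R b) \<and> T' \<noteq> {\<lambda>i. \<zero>} \<and>
    (\<forall>z\<in>T'. \<forall>i. z i \<in> m) \<and>
    stable_retract R (fr R b) T' (F (Suc i)) (d (Suc i) ` carrier (F (Suc (Suc i)))) \<and>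
    (\<forall>z\<in>T'. (\<lambda>i. projI (z i)) \<in> T')"
proof -
  have F: "fg_module R (F k)" "free_module R (F k)" for k using res by (simp_all add: fg_free_resolution_def)
  have F_mod: "module R (F k)" for k using F(1) by (simp add: fg_module_def)
  have d: "d k \<in> module_hom R (F (Suc k)) (F k)" for k using res by (simp add: fg_free_resolution_def)
  have exact: "d (Suc i) ` carrier (F (Suc (Suc i))) = {x \<in> carrier (F (Suc i)). d i x = \<zero>\<^bsub>F i\<^esub>}"
    using res by (simp add: fg_free_resolution_def)
  obtain S where S: "finite S" "generates R (fr R a) S T"
    using submodule_fr_finitely_generated[OF noetherian is_cring T(1)] by blast
  from minimal_cover[OF noetherian local module_fr T(1) S]
  obtain b p where p: "p \<in> module_hom R (fr R b) (fr R a)" "p ` carrier (fr R b) = T"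
    and ker: "\<forall>z\<in>carrier (fr R b). p z = \<zero>\<^bsub>fr R a\<^esub> \<longrightarrow> (\<forall>i. z i \<in> m)"
    by (elim exE bexE conjE)
  interpret B: module R "fr R b" by (rule module_fr)
  interpret A: module R "fr R a" by (rule module_fr)
  interpret p: mod_hom R "fr R b" "fr R a" p by unfold_locales (rule p(1))
  let ?K = "{z \<in> carrier (fr R b). p z = \<zero>\<^bsub>fr R a\<^esub>}"
  have "stable_retract R (fr R b) ?K (F (Suc i)) {x \<in> carrier (F (Suc i)). d i x = \<zero>\<^bsub>F i\<^esub>}"
    by (rule stable_retract_syzygies[OF one_not_zero fr_fg_free[OF one_not_zero] F
          fr_fg_free[OF one_not_zero] F_mod p(1) d]) (use ret p(2) in simp)
  then have ret': "stable_retract R (fr R b) ?K (F (Suc i)) (d (Suc i) ` carrier (F (Suc (Suc i))))"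
    unfolding exact .
  have sub: "LinearCombinations.submodule R ?K (fr R b)"
    by (rule submodule_hom_ker[OF module_fr module_fr p(1)])
  \<comment> \<open>\<open>T\<close> is nonzero, so there is a unit vector to use; \<open>T\<close>
    has coordinates in \<open>m\<close>, so a socle element times this unit vector is a nonzero
    vector of the kernel.\<close>
  have "?K \<noteq> {\<lambda>i. \<zero>}"
  proof -
    have "b \<noteq> 0"
    proof
      assume "b = 0"
      then have "v = \<zero>\<^bsub>fr R b\<^esub>" if "v \<in> carrier (fr R b)" for v
        using that by (auto simp: fr_carrier intro!: ext)
      then have "T \<subseteq> {\<zero>\<^bsub>fr R a\<^esub>}"
        using p(2) p.f0_is_0 by (metis imageE singletonI subsetI)
      moreover have "\<zero>\<^bsub>fr R a\<^esub> \<in> T" using T(1) by (rule LinearCombinations.submodule.zero_closed)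
      ultimately have "T = {\<zero>\<^bsub>fr R a\<^esub>}" by blast
      then show False using T(2) by simp
    qed
    then have u: "unitv R 0 \<in> carrier (fr R b)" by (intro unitv_closed) simp
    obtain x where x: "x \<in> J" "x \<noteq> \<zero>" "\<And>t. t \<in> m \<Longrightarrow> t \<otimes> x = \<zero>"
      using socle_element[OF ideal_J J_nonzero] by blast
    have xR: "x \<in> carrier R" using x(1) by (rule J.Icarr)
    have pm: "p (unitv R 0) i \<in> m" for i using Tm p(2) u by blast
    have "x \<otimes> p (unitv R 0) i = \<zero>" for i
      using x(3)[OF pm[of i]] m_comm[OF xR m.Icarr[OF pm[of i]]] by simp
    then have "p (x \<odot>\<^bsub>fr R b\<^esub> unitv R 0) = \<zero>\<^bsub>fr R a\<^esub>"
      unfolding p.f_smult[OF xR u] by simp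
    then have "x \<odot>\<^bsub>fr R b\<^esub> unitv R 0 \<in> ?K" using B.smult_closed[OF xR u] by blast
    moreover have "(x \<odot>\<^bsub>fr R b\<^esub> unitv R 0) 0 \<noteq> \<zero>" using x(2) xR by (simp add: unitv_def)
    ultimately show ?thesis by (metis singletonD)
  qed
  moreover have "(\<lambda>i. projI (z i)) \<in> ?K" if z: "z \<in> ?K" for z
  proof -
    let ?zI = "\<lambda>i. projI (z i)" and ?zJ = "\<lambda>i. z i \<ominus> projI (z i)"
    have zm: "z i \<in> m" for i using ker z by blast
    have zR: "z i \<in> carrier R" "projI (z i) \<in> carrier R" for i
      using m.Icarr[OF zm] I.Icarr[OF projI_in[OF zm]] by auto
    have "projI \<zero> = \<zero>" by (rule projI_I) simp
    then have c: "?zI \<in> carrier (fr R b)" "?zJ \<in> carrier (fr R b)"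
      using z zR by (auto simp: fr_carrier minus_eq)
    have "?zI \<oplus>\<^bsub>fr R b\<^esub> ?zJ = z"
    proof
      fix i
      have "projI (z i) \<oplus> (z i \<ominus> projI (z i)) = z i" using zR[of i] by algebra
      then show "(?zI \<oplus>\<^bsub>fr R b\<^esub> ?zJ) i = z i" by simp
    qed
    then have "p ?zI \<oplus>\<^bsub>fr R a\<^esub> p ?zJ = \<zero>\<^bsub>fr R a\<^esub>"
      using p.f_add[OF c] z by simp
    then have "p ?zI i \<oplus> p ?zJ i = \<zero> \<oplus> \<zero>" for i by (simp add: fun_eq_iff)
    moreover have "p ?zI i \<in> I" "p ?zJ i \<in> J" for i
      using hom_fr_coordinates[OF ideal_I p(1) c(1) projI_in[OF zm]]
        hom_fr_coordinates[OF ideal_J p(1) c(2) minus_projI_in[OF zm]] by auto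
    ultimately have "p ?zI i = \<zero>" for i
      using sum_I_J_unique(1) I.zero_closed J.zero_closed by blast
    then have "p ?zI = \<zero>\<^bsub>fr R a\<^esub>" by auto
    then show ?thesis using c by blast
  qed
  ultimately show ?thesis using sub ret' ker
    by (intro exI[of _ b] exI[of _ ?K] conjI) auto
qed

text \<open>A nonfree \<open>M\<close> has nonzero minimal syzygies in all degrees, each a stable
  retract of the corresponding syzygy in \<open>F\<close>. Far enough out, the splitting yields a
  nonzero one with all coordinates in \<open>I\<close> or all in \<open>J\<close>, which
  \<open>not_stable_retract\<close> forbids.\<close>

lemma Ext_eventually_zero_imp_free:
  assumes fg: "fg_module R M" and res: "fg_free_resolution R M F d e"
    and ext: "\<And>i. n \<le> i \<Longrightarrow> homs_extend R (F i) (d i ` carrier (F (Suc i)))"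
  shows "free_module R M"
proof (rule ccontr)
  assume nonfree: "\<not> free_module R M"
  interpret M: module R M using fg by (simp add: fg_module_def)
  have F: "fg_module R (F k)" "free_module R (F k)" for k using res by (simp_all add: fg_free_resolution_def)
  have syz: "\<exists>a T. LinearCombinations.submodule R T (fr R a) \<and> T \<noteq> {\<lambda>i. \<zero>} \<and>
    (\<forall>z\<in>T. \<forall>i. z i \<in> m) \<and> stable_retract R (fr R a) T (F i) (d i ` carrier (F (Suc i)))" for i
  proof (induction i)
    case 0
    have M_sub: "LinearCombinations.submodule R (carrier M) M"
      by (auto simp: LinearCombinations.submodule_def M.module_axioms)
    obtain S where S: "finite S" "generates R M S (carrier M)"
      using fg_module_generates[OF fg] by blast
    from minimal_cover[OF noetherian local M.module_axioms M_sub S]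
    obtain a p where p: "p \<in> module_hom R (fr R a) M" "p ` carrier (fr R a) = carrier M"
      and ker: "\<forall>z\<in>carrier (fr R a). p z = \<zero>\<^bsub>M\<^esub> \<longrightarrow> (\<forall>i. z i \<in> m)"
      by (elim exE bexE conjE)
    let ?T = "{z \<in> carrier (fr R a). p z = \<zero>\<^bsub>M\<^esub>}"
    have e: "e \<in> module_hom R (F 0) M" "e ` carrier (F 0) = carrier M"
      and exact: "d 0 ` carrier (F (Suc 0)) = {x \<in> carrier (F 0). e x = \<zero>\<^bsub>M\<^esub>}"
      using res by (simp_all add: fg_free_resolution_def)
    have "stable_retract R (fr R a) ?T (F 0) (d 0 ` carrier (F (Suc 0)))"
      unfolding exact
      by (rule stable_retract_covers[OF one_not_zero fr_fg_free[OF one_not_zero] F M.module_axioms p e])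
    \<comment> \<open>Non-freeness enters here: with zero kernel the minimal cover would be an
      isomorphism from \<open>R^a\<close>.\<close>
    moreover have "?T \<noteq> {\<lambda>i. \<zero>}"
    proof
      assume "?T = {\<lambda>i. \<zero>}"
      then have "free_module R M"
        by (intro free_module_if_bij[OF one_not_zero M.module_axioms p]) blast
      then show False using nonfree by simp
    qed
    ultimately show ?case
      using submodule_hom_ker[OF module_fr M.module_axioms p(1)] ker
      by (intro exI[of _ a] exI[of _ ?T] conjI) auto
  next
    case (Suc i)
    then obtain a T where T: "LinearCombinations.submodule R T (fr R a)" "T \<noteq> {\<lambda>i. \<zero>}"
      "\<forall>z\<in>T. \<forall>i. z i \<in> m" "stable_retract R (fr R a) T (F i) (d i ` carrier (F (Suc i)))"
      by (elim exE conjE)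
    from minimal_syzygy[where F = F and d = d and i = i, OF res T]
    show ?case by blast
  qed
  obtain a T where T: "LinearCombinations.submodule R T (fr R a)" "T \<noteq> {\<lambda>i. \<zero>}"
    "\<forall>z\<in>T. \<forall>i. z i \<in> m" "stable_retract R (fr R a) T (F n) (d n ` carrier (F (Suc n)))"
    using syz[of n] by (elim exE conjE)
  \<comment> \<open>\<open>syz\<close> does not record the splitting, so one more syzygy is taken
    from degree \<open>n\<close>.\<close>
  from minimal_syzygy[where F = F and d = d and i = n, OF res T]
  obtain b X where X: "LinearCombinations.submodule R X (fr R b)" "X \<noteq> {\<lambda>i. \<zero>}"
    and Xm: "\<forall>z\<in>X. \<forall>i. z i \<in> m"
    and ret: "stable_retract R (fr R b) X (F (Suc n)) (d (Suc n) ` carrier (F (Suc (Suc n))))"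
    and split: "\<forall>z\<in>X. (\<lambda>i. projI (z i)) \<in> X"
    by (elim exE conjE)
  interpret X: LinearCombinations.submodule R X "fr R b" by (rule X(1))
  \<comment> \<open>\<open>X\<close> sits at index \<open>Suc n\<close>, and
    \<open>not_stable_retract\<close> asks for extensions one index later.\<close>
  have ext': "homs_extend R (F (Suc (Suc n))) (d (Suc (Suc n)) ` carrier (F (Suc (Suc (Suc n)))))"
    by (rule ext) simp
  \<comment> \<open>The intersection of \<open>X\<close> with \<open>I R^b\<close>. If it is zero,
    all \<open>I\<close>-parts vanish and \<open>X\<close> itself has coordinates in
    \<open>J\<close>; otherwise it is a summand of \<open>X\<close> by \<open>projI\<close>, and the
    roles of \<open>I\<close> and \<open>J\<close> are exchanged.\<close>
  let ?A = "{z \<in> X. \<forall>i. z i \<in> I}"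
  have A: "LinearCombinations.submodule R ?A (fr R b)"
    unfolding LinearCombinations.submodule_def
    using X(1) I.I_l_closed by (auto simp: LinearCombinations.submodule_def)
  show False
  proof (cases "?A = {\<lambda>i. \<zero>}")
    case True
    have "\<forall>z\<in>X. \<forall>i. z i \<in> J"
    proof (intro ballI allI)
      fix z i assume z: "z \<in> X"
      have zm: "z i \<in> m" for i using Xm z by blast
      then have "(\<lambda>i. projI (z i)) \<in> ?A" using split z projI_in by blast
      then have "(\<lambda>i. projI (z i)) = (\<lambda>i. \<zero>)" using True by blast
      then have "projI (z i) = \<zero>" by (rule fun_cong)
      then show "z i \<in> J" using minus_projI_in[OF zm[of i]] m.Icarr[OF zm[of i]] by (simp add: minus_eq)
    qed
    from not_stable_retract[where F = F and d = d and i = "Suc n", OF res X this ext'] ret show False by blast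
  next
    case False
    have Xm': "z i \<in> m" if "z \<in> X" for z i using Xm that by blast
    have "(\<lambda>z i. projI (z i)) \<in> module_hom R ((fr R b)\<lparr>carrier := X\<rparr>) (fr R b)"
      unfolding module_hom_def
    proof (intro CollectI conjI allI impI funcsetI)
      show "(\<lambda>i. projI (z i)) \<in> carrier (fr R b)" if "z \<in> carrier ((fr R b)\<lparr>carrier := X\<rparr>)" for z
        using split that X.subset by auto
      show "(\<lambda>i. projI ((z \<oplus>\<^bsub>(fr R b)\<lparr>carrier := X\<rparr>\<^esub> z') i))
          = (\<lambda>i. projI (z i)) \<oplus>\<^bsub>fr R b\<^esub> (\<lambda>i. projI (z' i))"
        if "z \<in> carrier ((fr R b)\<lparr>carrier := X\<rparr>) \<and> z' \<in> carrier ((fr R b)\<lparr>carrier := X\<rparr>)" for z z'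
        using that projI_add Xm' by simp
      show "(\<lambda>i. projI ((r \<odot>\<^bsub>(fr R b)\<lparr>carrier := X\<rparr>\<^esub> z) i)) = r \<odot>\<^bsub>fr R b\<^esub> (\<lambda>i. projI (z i))"
        if "r \<in> carrier R \<and> z \<in> carrier ((fr R b)\<lparr>carrier := X\<rparr>)" for r z
        using that projI_mult Xm' by simp
    qed
    moreover have "(\<lambda>z i. projI (z i)) ` X \<subseteq> ?A"
      using split Xm' projI_in by (auto simp: image_subset_iff)
    ultimately have "stable_retract R (fr R b) ?A (F (Suc n)) (d (Suc n) ` carrier (F (Suc (Suc n))))"
      by (rule stable_retract_summand[OF ret X.subset]) (auto simp: projI_I)
    moreover have "\<not> stable_retract R (fr R b) ?A (F (Suc n)) (d (Suc n) ` carrier (F (Suc (Suc n))))"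
      by (rule decomposable_local_ring.not_stable_retract[where F = F and d = d and i = "Suc n", OF swap res A False _ ext']) blast
    ultimately show False by blast
  qed
qed

end

text \<open>\<open>Ext\<close> is computed from a triple chosen by \<open>SOME\<close>. Since
  resolutions exist, the chosen triple is one, and vanishing of \<open>Ext\<close> is vanishing of
  the cohomology for this very \<open>F\<close>.\<close>

lemma Ext_zero_imp_free:
  fixes R (structure) and M :: "('a, 'm) module"
  assumes R: "noetherian_ring R" "local_ring R m" "decomposable_ideal R m" "artinian_ring R"
    and M: "fg_module R M" and zero: "\<forall>i>n. zero_module (Ext R M (ring_module R) i)"
  shows "free_module R M"
proof -
  from R(3) obtain I J where "decomposable_local_ring_axioms R m I J"
    using R unfolding decomposable_ideal_def decomposable_local_ring_axioms_def by blast
  moreover have "cring R" using R(2) by (simp add: local_ring_def)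
  ultimately interpret decomposable_local_ring R m I J by (intro decomposable_local_ring.intro)
  obtain F d e where F: "(SOME (F :: nat \<Rightarrow> ('a, nat \<Rightarrow> 'a) module, d, e). fg_free_resolution R M F d e) = (F, d, e)"
    by (metis prod_cases3)
  have "\<exists>x. case x of (F :: nat \<Rightarrow> ('a, nat \<Rightarrow> 'a) module, d, e) \<Rightarrow> fg_free_resolution R M F d e"
    using fg_free_resolution_exists[OF R(1) is_cring one_not_zero M] by auto
  from someI_ex[OF this] have res: "fg_free_resolution R M F d e" unfolding F by simp
  \<comment> \<open>Degree \<open>Suc i\<close> of \<open>Ext\<close> controls the image of
    \<open>d i\<close>, so vanishing above \<open>n\<close> serves all \<open>i\<close> from
    \<open>n\<close> on.\<close>
  have "homs_extend R (F i) (d i ` carrier (F (Suc i)))" if "n \<le> i" for i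
  proof (rule Ext_zero_homs_extend[OF is_cring res])
    have "zero_module (Ext R M (ring_module R) (Suc i))" using zero that by simp
    then show "zero_module (hom_cohomology R F d (ring_module R) (Suc i))"
      unfolding Ext_def F by simp
  qed
  then show ?thesis by (rule Ext_eventually_zero_imp_free[OF M res])
qed

theorem corollary3p8:
  fixes R :: "('a, 'r) ring_scheme" and m :: "'a set"
  assumes "noetherian_ring R"
    and "local_ring R m"
    and "decomposable_ideal R m"
    and "artinian_ring R"
  shows "(\<nexists>M :: ('a, 'm) module. fg_module R M \<and> \<not> free_module R M \<and>
            (\<exists>n. \<forall>i>n. zero_module (Ext R M (ring_module R) i)))
       \<and> (\<nexists>X :: ('a, 'm) module. totally_reflexive R X \<and> \<not> free_module R X)"
  \<comment> \<open>For totally reflexive modules the bound \<open>n = 0\<close> applies.\<close>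
  using Ext_zero_imp_free[OF assms] unfolding totally_reflexive_def by blast

end
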